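(* Let $k\ge 2$ be a constant integer and let $f(n)=o(\log\log n)$ be an arbitrary function with $f(n)\to\infty$. Let $G(n)$ be a random $k$-tree on $n+k$ vertices, and suppose that initially a vertex of $G(n)$ chosen uniformly at random knows a rumor. Then there is a constant $C>0$ such that, with probability $1-o(1)$ as $n\to\infty$, after $C\,(\log n)^{1+\frac{2}{k}}\cdot \log\log n\cdot f(n)^{\frac{3}{k}}$ rounds of the Push-Pull protocol, at least $n-o(n)$ vertices know the rumor.
   Context: Random $k$-tree process: $G(0)$ is a clique on $k$ vertices; for $t=1,2,\dots,n$, $G(t)$ is obtained from $G(t-1)$ by choosing a $k$-clique of $G(t-1)$ uniformly at random, creating a new vertex, and joining it to all $k$ vertices of the chosen clique. $G(n)$ is called a random $k$-tree on $n+k$ vertices. Push-Pull protocol on a graph: initially some vertices know a rumor; the protocol proceeds in synchronous rounds; in each round, every informed vertex contacts a uniformly random neighbor and sends it the rumor (push), and every uninformed vertex contacts a uniformly random neighbor and receives the rumor if that neighbor knows it (pull); all random choices are independent, and a vertex informed in a round cannot forward the rumor in that same round. *)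

theory Defs
  imports "HOL-Probability.Probability" "HOL-Library.Landau_Symbols"
begin

text \<open>Graphs on vertex set {..<N} are represented by their edge sets,
  each edge being a two-element set of vertices.\<close>
type_synonym graph = "nat set set"

definition complete_graph :: "nat \<Rightarrow> graph" where
  "complete_graph k = {{u, v} | u v. u < k \<and> v < k \<and> u \<noteq> v}"

definition kcliques :: "nat \<Rightarrow> nat \<Rightarrow> graph \<Rightarrow> nat set set" where
  "kcliques k N E = {S. S \<subseteq> {..<N} \<and> card S = k \<and>
      (\<forall>u\<in>S. \<forall>v\<in>S. u \<noteq> v \<longrightarrow> {u, v} \<in> E)}"

definition ktree_step :: "nat \<Rightarrow> nat \<Rightarrow> graph \<Rightarrow> graph pmf" where
  "ktree_step k t E = map_pmf (\<lambda>S. E \<union> {{v, k + t} | v. v \<in> S})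
      (pmf_of_set (kcliques k (k + t) E))"

primrec random_ktree :: "nat \<Rightarrow> nat \<Rightarrow> graph pmf" where
  "random_ktree k 0 = return_pmf (complete_graph k)"
| "random_ktree k (Suc t) = bind_pmf (random_ktree k t) (ktree_step k t)"

definition nbrs :: "graph \<Rightarrow> nat \<Rightarrow> nat set" where
  "nbrs E v = {u. {u, v} \<in> E}"

text \<open>One synchronous round of Push-Pull on graph E with vertex set {..<N},
  starting from informed set I: each vertex v independently contacts a uniformly
  random neighbour c v. Informed vertices push to c v; uninformed vertices pull
  from c v if c v is informed (informed at the start of the round).\<close>
definition push_pull_round :: "graph \<Rightarrow> nat \<Rightarrow> nat set \<Rightarrow> nat set pmf" where
  "push_pull_round E N I = map_pmf
      (\<lambda>c. I \<union> c ` I \<union> {v \<in> {..<N}. v \<notin> I \<and> c v \<in> I})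
      (Pi_pmf {..<N} 0 (\<lambda>v. pmf_of_set (nbrs E v)))"

primrec push_pull :: "graph \<Rightarrow> nat \<Rightarrow> nat set \<Rightarrow> nat \<Rightarrow> nat set pmf" where
  "push_pull E N I 0 = return_pmf I"
| "push_pull E N I (Suc r) = bind_pmf (push_pull E N I r) (push_pull_round E N)"

definition rumor_spread :: "nat \<Rightarrow> nat \<Rightarrow> nat \<Rightarrow> nat set pmf" where
  "rumor_spread k n r =
     bind_pmf (random_ktree k n) (\<lambda>G.
     bind_pmf (pmf_of_set {..<n + k}) (\<lambda>v.
     push_pull G (n + k) {v} r))"

definition num_rounds :: "real \<Rightarrow> nat \<Rightarrow> (nat \<Rightarrow> real) \<Rightarrow> nat \<Rightarrow> nat" where
  "num_rounds C k f n = nat \<lceil>C * ln (real n) powr (1 + 2 / real k) * ln (ln (real n))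
      * f n powr (3 / real k)\<rceil>"

end

theory Submission
  imports Defs "HOL-Real_Asymp.Real_Asymp"
begin

text \<open>Crossing an edge is slow only if both ends have large degree. The oldest vertices have
  degrees of order a power of \<open>n\<close>, so the early part of a path is the obstacle and
  calls for detours through young vertices. Stopping at \<open>m\<close> makes a union bound over
  the early edges possible: they are determined by the graph at time \<open>m\<close> and the piece,
  whereas hubs are decided by later choices. So one estimate conditional on time \<open>m\<close>,
  of size o(1 / ln n), serves each of the O(ln n) edges. The times have different duties. The degree
  of a hub is of order (n / s)^((k-1)/k), so \<open>n / s\<close> must be small. For
  \<open>k \<ge> 3\<close> a hit between \<open>m\<close> and \<open>s\<close> increases the number
  of cliques around an edge and makes a hub likely; the main risk is that nothing at all hits its
  first \<open>k - 1\<close> cliques after \<open>m\<close>, of probability about (n /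
  m)^(-(k-1)/k). For \<open>k = 2\<close> hits do not increase that number, and the two times
  coincide. The budget (ln n)^(1 + 2/k) is used twice, up to smaller factors: by O(ln n) early
  detours of cost (ln n)^(2/k), and by few late edges of cost \<open>n / m\<close> each.\<close>

text \<open>
  If a walk from \<open>x\<close> to \<open>y\<close> has an endpoint of degree at most \<open>q\<^sub>i\<close> on its \<open>i\<close>-th edge, then the rumor
  crosses that edge in each round with probability at least \<open>1 / q\<^sub>i\<close>, so it travels from \<open>x\<close> to \<open>y\<close>
  in \<open>O(\<Sum> q\<^sub>i)\<close> rounds. Hence it suffices to connect almost every vertex to vertex \<open>0\<close> by a cheap walk:
  two such walks join the source to almost every vertex.

  Follow from a vertex the newest vertex of the clique it was attached to; this path behaves like
  a path in a random recursive tree and has logarithmic length. Stop the process at times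
  \<open>m < s < n\<close>, where \<open>n / m\<close> and \<open>n / s\<close> are powers of \<open>ln n\<close>. The \<open>O(ln (ln n))\<close> edges of the path
  created after time \<open>m\<close> have an endpoint whose degree is at most the size of the piece of the tree
  that hangs off one clique of the graph at time \<open>m\<close>. An edge created before time \<open>m\<close> is replaced by
  a path through its hub, the first vertex attached after time \<open>s\<close> to a clique containing the edge.
  Being young, the hub has small degree up to a factor \<open>ln (ln n)\<close>, by high moments of
  a Polya urn. That an edge has no hub is so unlikely (by an exponential potential of the urn counting
  the cliques that contain it) that a path of length \<open>O(ln n)\<close> rarely meets such an edge.
\<close>

section \<open>Push-Pull along a walk\<close>

lemma prob_bind_pmf:
  "measure_pmf.prob (bind_pmf p f) X = measure_pmf.expectation p (\<lambda>x. measure_pmf.prob (f x) X)"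
proof -
  have "ennreal (measure_pmf.prob (bind_pmf p f) X) = (\<integral>\<^sup>+x. ennreal (measure_pmf.prob (f x) X) \<partial>p)"
    by (simp flip: measure_pmf.emeasure_eq_measure)
  also have "\<dots> = ennreal (measure_pmf.expectation p (\<lambda>x. measure_pmf.prob (f x) X))"
    by (intro nn_integral_eq_integral measure_pmf.integrable_const_bound[where B = 1]) auto
  finally show ?thesis
    by (subst (asm) ennreal_inj) (auto intro!: integral_nonneg_AE)
qed

text \<open>One round of the walk argument: on \<open>H\<close> the next edge has been crossed and
  the bound drops to \<open>a\<close>; otherwise the old bound \<open>b\<close> still
  applies.\<close>

lemma expectation_two_valued_le:
  fixes a b q :: real
  assumes "a \<le> b" "q \<le> measure_pmf.prob p H"
    and "\<And>x. x \<in> set_pmf p \<Longrightarrow> g x \<le> (if x \<in> H then a else b)"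
    and "\<And>x. 0 \<le> g x" "\<And>x. g x \<le> 1"
  shows "measure_pmf.expectation p g \<le> b - (b - a) * q"
proof -
  have int: "integrable (measure_pmf p) g"
    by (intro measure_pmf.integrable_const_bound[where B = 1]) (use assms in auto)
  have "measure_pmf.expectation p g \<le> measure_pmf.expectation p (\<lambda>x. b - (b - a) * indicator H x)"
  proof (intro integral_mono_AE int AE_pmfI)
    show "integrable (measure_pmf p) (\<lambda>x. b - (b - a) * indicator H x)"
      by (intro measure_pmf.integrable_const_bound[where B = "\<bar>b\<bar> + \<bar>b - a\<bar>"]) (auto simp: indicator_def)
    show "g x \<le> b - (b - a) * indicator H x" if "x \<in> set_pmf p" for x
      using assms(3)[OF that] by (auto simp: indicator_def split: if_splits)
  qed
  also have "\<dots> = b - (b - a) * measure_pmf.prob p H"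
    by (subst Bochner_Integration.integral_diff)
       (auto intro!: integrable_mult_right measure_pmf.integrable_const_bound[where B = 1 and f = "indicator H"])
  also have "\<dots> \<le> b - (b - a) * q"
    using assms(1,2) by (simp add: mult_left_mono)
  finally show ?thesis .
qed

lemma push_pull_Suc_first:
  "push_pull E N I (Suc r) = bind_pmf (push_pull_round E N I) (\<lambda>J. push_pull E N J r)"
proof (induction r)
  case (Suc r)
  have "push_pull E N I (Suc (Suc r)) = bind_pmf (push_pull E N I (Suc r)) (push_pull_round E N)"
    by simp
  also have "\<dots> = bind_pmf (push_pull_round E N I) (\<lambda>J. push_pull E N J (Suc r))"
    by (subst Suc.IH) (simp add: bind_assoc_pmf)
  finally show ?case .
qed (simp add: bind_return_pmf bind_return_pmf')

lemma push_pull_round_mono: "J \<in> set_pmf (push_pull_round E N I) \<Longrightarrow> I \<subseteq> J"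
  by (auto simp: push_pull_round_def)

lemma push_pull_mono: "J \<in> set_pmf (push_pull E N I r) \<Longrightarrow> I \<subseteq> J"
  by (induction r arbitrary: J) (auto dest!: push_pull_round_mono)

lemma push_pull_finite: "finite I \<Longrightarrow> J \<in> set_pmf (push_pull E N I r) \<Longrightarrow> finite J"
  by (induction r arbitrary: J) (auto simp: push_pull_round_def)

text \<open>Only the contact made by the low-degree end \<open>u\<close> is used: it picks
  \<open>v\<close> with probability at least \<open>1 / q\<close>. This is a push if
  \<open>u\<close> is informed, and a pull if only \<open>v\<close> is.\<close>

lemma push_pull_round_edge:
  assumes "finite (nbrs E u)" "{u, v} \<in> E" "u < N" "real (card (nbrs E u)) \<le> q"
    and uv: "u \<in> I \<and> w = v \<or> v \<in> I \<and> w = u"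
  shows "1 / q \<le> measure_pmf.prob (push_pull_round E N I) {J. w \<in> J}"
proof -
  have v: "v \<in> nbrs E u" using assms(2) by (simp add: nbrs_def insert_commute)
  have pos: "card (nbrs E u) > 0" using v assms(1) by (auto simp: card_gt_0_iff)
  have "1 / q \<le> 1 / real (card (nbrs E u))"
    using pos assms(4) by (intro divide_left_mono) auto
  also have "\<dots> = measure_pmf.prob (pmf_of_set (nbrs E u)) {v}"
    using v assms(1) by (subst measure_pmf_of_set) auto
  also have "\<dots> = measure_pmf.prob (map_pmf (\<lambda>c. c u) (Pi_pmf {..<N} 0 (\<lambda>v. pmf_of_set (nbrs E v)))) {v}"
    using assms(3) by (simp add: Pi_pmf_component)
  also have "\<dots> = measure_pmf.prob (Pi_pmf {..<N} 0 (\<lambda>v. pmf_of_set (nbrs E v))) {c. c u = v}"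
    by (simp add: vimage_def)
  also have "\<dots> \<le> measure_pmf.prob (Pi_pmf {..<N} 0 (\<lambda>v. pmf_of_set (nbrs E v)))
      {c. w \<in> I \<union> c ` I \<union> {v \<in> {..<N}. v \<notin> I \<and> c v \<in> I}}"
    using uv assms(3) by (intro measure_pmf.finite_measure_mono) auto
  also have "\<dots> = measure_pmf.prob (push_pull_round E N I) {J. w \<in> J}"
    by (simp add: push_pull_round_def vimage_def)
  finally show ?thesis .
qed

text \<open>\<open>walk E M x y Q\<close>: a walk from \<open>x\<close> to \<open>y\<close> whose total cost is \<open>Q\<close>, where the cost of an edge
  bounds the smaller of its two degrees (hence the expected time to cross it) and is at most \<open>M\<close>.\<close>
inductive walk :: "graph \<Rightarrow> real \<Rightarrow> nat \<Rightarrow> nat \<Rightarrow> real \<Rightarrow> bool" for E M where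
  stay: "walk E M x x 0"
| step: "{x, z} \<in> E \<Longrightarrow> 0 < q \<Longrightarrow> q \<le> M \<Longrightarrow>
    real (card (nbrs E x)) \<le> q \<or> real (card (nbrs E z)) \<le> q \<Longrightarrow> walk E M z y Q \<Longrightarrow> walk E M x y (q + Q)"

lemma walk_edge:
  "{x, z} \<in> E \<Longrightarrow> 0 < q \<Longrightarrow> q \<le> M \<Longrightarrow> real (card (nbrs E x)) \<le> q \<or> real (card (nbrs E z)) \<le> q
    \<Longrightarrow> walk E M x z q"
  using walk.step[OF _ _ _ _ walk.stay, of x z E q M] by simp

lemma walk_trans: "walk E M x y Q \<Longrightarrow> walk E M y z Q' \<Longrightarrow> walk E M x z (Q + Q')"
  by (induction rule: walk.induct) (auto simp: add.assoc intro: walk.step)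

lemma walk_sym: "walk E M x y Q \<Longrightarrow> walk E M y x Q"
proof (induction rule: walk.induct)
  case (step x z q y Q)
  have "walk E M z x q"
    using step by (intro walk_edge) (auto simp: insert_commute)
  from walk_trans[OF step.IH this] show ?case by (simp add: add.commute)
qed (rule walk.stay)

lemma walk_nonneg: "walk E M x y Q \<Longrightarrow> 0 \<le> Q"
  by (induction rule: walk.induct) auto

lemma one_minus_exp_ge_half:
  fixes x :: real assumes "0 \<le> x" "x \<le> 1" shows "x / 2 \<le> 1 - exp (- x)"
proof -
  have "exp (- x) \<le> 1 / (1 + x)"
    using exp_ge_add_one_self[of x] assms by (simp add: exp_minus inverse_eq_divide divide_left_mono)
  also have "1 / (1 + x) \<le> 1 - x / 2"
    using assms mult_left_le[of x x] by (simp add: field_simps)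
  finally show ?thesis by simp
qed

text \<open>The potential \<open>exp (Q / M)\<close>, with \<open>Q\<close> the cost still to be covered, decreases on average
  by a factor \<open>exp (-1 / (2 M))\<close> per round.\<close>
lemma push_pull_walk:
  assumes "walk E M x y Q" "M > 0" and E: "\<And>u v. {u, v} \<in> E \<Longrightarrow> u < N"
    and "x \<in> I"
  shows "measure_pmf.prob (push_pull E N I T) {J. y \<notin> J} \<le> exp ((2 * Q - real T) / (2 * M))"
  using assms(1,4)
proof (induction T arbitrary: I x Q)
  case 0
  from walk_nonneg[OF 0(1)] \<open>M > 0\<close> have "1 \<le> exp ((2 * Q - real 0) / (2 * M))" by simp
  then show ?case by (smt (verit) measure_pmf.prob_le_1)
next
  case (Suc T)
  show ?case
    using Suc.prems(1)
  proof (cases rule: walk.cases)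
    case stay
    have "{J. y \<notin> J} \<inter> set_pmf (push_pull E N I (Suc T)) = {}"
      using push_pull_mono[of _ E N I "Suc T"] Suc.prems(2) stay by blast
    then have "measure_pmf.prob (push_pull E N I (Suc T)) {J. y \<notin> J} = 0"
      by (subst measure_Int_set_pmf[symmetric]) simp
    then show ?thesis by simp
  next
    case (step z q Q')
    define b where "b = exp ((2 * Q - real T) / (2 * M))"
    define a where "a = exp ((2 * Q' - real T) / (2 * M))"
    have fin: "finite (nbrs E u)" for u
      by (rule finite_subset[of _ "{..<N}"]) (auto simp: nbrs_def E)
    have ab: "a = b * exp (- (q / M))"
      using \<open>M > 0\<close> step by (simp add: a_def b_def flip: exp_add) (simp add: field_simps)
    have a_le: "a \<le> b" using ab \<open>M > 0\<close> step by (simp add: b_def)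
    have xz: "x < N" "z < N" using E step by (blast, metis insert_commute)
    have zx: "{z, x} \<in> E" using step by (simp add: insert_commute)
    have "1 / q \<le> measure_pmf.prob (push_pull_round E N I) {J. z \<in> J}"
      using step(5) push_pull_round_edge[of E x z N q I z, OF fin _ xz(1)]
        push_pull_round_edge[of E z x N q I z, OF fin zx xz(2)] step(2) Suc.prems(2) by blast
    then have "measure_pmf.expectation (push_pull_round E N I)
        (\<lambda>J. measure_pmf.prob (push_pull E N J T) {J. y \<notin> J}) \<le> b - (b - a) * (1 / q)"
    proof (rule expectation_two_valued_le[OF a_le])
      fix J assume "J \<in> set_pmf (push_pull_round E N I)"
      then have "x \<in> J" using push_pull_round_mono Suc.prems(2) by blast
      then show "measure_pmf.prob (push_pull E N J T) {J. y \<notin> J} \<le> (if J \<in> {J. z \<in> J} then a else b)"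
        using Suc.IH[OF Suc.prems(1)] Suc.IH[OF step(6)] by (auto simp: a_def b_def)
    qed auto
    also have "(b - a) * (1 / q) = b * ((1 - exp (- (q / M))) / q)"
      unfolding ab by (simp add: field_simps)
    also have "b - \<dots> \<le> b - b * (1 / (2 * M))"
    proof -
      \<comment> \<open>The bound \<open>q \<le> M\<close> keeps \<open>q / M\<close> where
        \<open>1 - exp (- x)\<close> is at least \<open>x / 2\<close>, so the gain per round is
        \<open>1 / (2 * M)\<close> whatever the edge costs.\<close>
      have "q / M / 2 \<le> 1 - exp (- (q / M))"
        using step \<open>M > 0\<close> by (intro one_minus_exp_ge_half) auto
      then have "1 / (2 * M) \<le> (1 - exp (- (q / M))) / q"
        using step \<open>M > 0\<close> by (simp add: field_simps)
      then show ?thesis by (intro diff_left_mono mult_left_mono) (auto simp: b_def)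
    qed
    also have "\<dots> = b * (1 + - (1 / (2 * M)))" by (simp add: algebra_simps)
    also have "\<dots> \<le> b * exp (- (1 / (2 * M)))"
      by (intro mult_left_mono exp_ge_add_one_self) (simp add: b_def)
    also have "\<dots> = exp ((2 * Q - real (Suc T)) / (2 * M))"
      using \<open>M > 0\<close> by (simp add: b_def field_simps flip: exp_add)
    finally show ?thesis
      by (simp only: push_pull_Suc_first prob_bind_pmf)
  qed
qed

section \<open>The tree of cliques\<close>

text \<open>A run of the process is the list of the chosen cliques, most recent first. The \<open>k * t + 1\<close>
  cliques present at time \<open>t\<close> are numbered from \<open>0\<close>; step \<open>t\<close> creates the numbers
  \<open>k * t + 1, \<dots>, k * t + k\<close>, each replacing one entry of the chosen clique by the new vertex.
  The \<open>mod\<close> only matters for numbers that do not exist, so that most facts hold for arbitrary lists.\<close>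
primrec clique_at :: "nat \<Rightarrow> nat list \<Rightarrow> nat \<Rightarrow> nat list" where
  "clique_at k [] i = [0..<k]"
| "clique_at k (c # h) i = (if i \<le> k * length h then clique_at k h i
     else (clique_at k h c)[(i - Suc (k * length h)) mod k := k + length h])"

primrec ktree_of :: "nat \<Rightarrow> nat list \<Rightarrow> graph" where
  "ktree_of k [] = complete_graph k"
| "ktree_of k (c # h) = ktree_of k h \<union> {{v, k + length h} | v. v \<in> set (clique_at k h c)}"

primrec newest :: "nat \<Rightarrow> nat list \<Rightarrow> nat \<Rightarrow> nat" where
  "newest k [] i = 0"
| "newest k (c # h) i = (if i \<le> k * length h then newest k h i else k + length h)"

text \<open>The creation times along the path from clique \<open>i\<close> up to the initial clique.\<close>
primrec chain :: "nat \<Rightarrow> nat list \<Rightarrow> nat \<Rightarrow> nat list" where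
  "chain k [] i = []"
| "chain k (c # h) i = (if i \<le> k * length h then chain k h i else length h # chain k h c)"

text \<open>The newest vertex of the clique chosen at time \<open>s\<close>, i.e. the next vertex after \<open>k + s\<close> on
  the walks towards vertex \<open>0\<close>.\<close>
primrec parent :: "nat \<Rightarrow> nat list \<Rightarrow> nat \<Rightarrow> nat" where
  "parent k [] s = 0"
| "parent k (c # h) s = (if s < length h then parent k h s else newest k h c)"

text \<open>The clique of the graph at time \<open>m\<close> to whose piece clique \<open>i\<close> belongs.\<close>
primrec piece_of :: "nat \<Rightarrow> nat \<Rightarrow> nat list \<Rightarrow> nat \<Rightarrow> nat" where
  "piece_of k m [] i = i"
| "piece_of k m (c # h) i = (if i \<le> k * length h then piece_of k m h i
     else if length h < m then i else piece_of k m h c)"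

definition containing :: "nat \<Rightarrow> nat list \<Rightarrow> nat set \<Rightarrow> nat set" where
  "containing k h e = {i. i \<le> k * length h \<and> e \<subseteq> set (clique_at k h i)}"

definition piece :: "nat \<Rightarrow> nat \<Rightarrow> nat list \<Rightarrow> nat \<Rightarrow> nat set" where
  "piece k m h A = {i. i \<le> k * length h \<and> piece_of k m h i = A}"

text \<open>The first vertex attached at time \<open>s\<close> or later to a clique containing \<open>e\<close>.\<close>
primrec first_hub :: "nat \<Rightarrow> nat \<Rightarrow> nat set \<Rightarrow> nat list \<Rightarrow> nat option" where
  "first_hub k s e [] = None"
| "first_hub k s e (c # h) = (case first_hub k s e h of Some w \<Rightarrow> Some w
     | None \<Rightarrow> if s \<le> length h \<and> e \<subseteq> set (clique_at k h c) then Some (k + length h) else None)"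

lemma length_clique_at [simp]: "length (clique_at k h i) = k"
  by (induction h arbitrary: i) auto

lemma clique_at_less: "x \<in> set (clique_at k h i) \<Longrightarrow> x < k + length h"
proof (induction h arbitrary: i)
  case (Cons c h)
  then show ?case
    using set_update_subset_insert[of "clique_at k h c" "(i - Suc (k * length h)) mod k" "k + length h"]
    by (fastforce split: if_splits)
qed auto

lemma distinct_clique_at [simp]: "distinct (clique_at k h i)"
  by (induction h arbitrary: i) (auto intro!: distinct_list_update dest: clique_at_less)

lemma finite_containing [simp]: "finite (containing k h e)"
  by (rule finite_subset[of _ "{..k * length h}"]) (auto simp: containing_def)

lemma finite_piece [simp]: "finite (piece k m h A)"
  by (rule finite_subset[of _ "{..k * length h}"]) (auto simp: piece_def)

lemma set_clique_at_new:
  assumes "i < k"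
  shows "set (clique_at k (c # h) (Suc (k * length h + i))) = insert (k + length h) (set (clique_at k h c) - {clique_at k h c ! i})"
  using assms by (simp add: set_update_distinct)

lemma set_clique_at_new':
  assumes "k \<ge> 1" "\<not> i \<le> k * length h"
  obtains j where "j < k" "set (clique_at k (c # h) i) = insert (k + length h) (set (clique_at k h c) - {clique_at k h c ! j})"
proof
  show "(i - Suc (k * length h)) mod k < k" using assms by simp
  then show "set (clique_at k (c # h) i) = insert (k + length h) (set (clique_at k h c) - {clique_at k h c ! ((i - Suc (k * length h)) mod k)})"
    using assms by (simp add: set_update_distinct)
qed

section \<open>Counting cliques by their numbers\<close>

lemma ids_Suc:
  "{i. i \<le> k * Suc n \<and> P i} = {i. i \<le> k * n \<and> P i} \<union> (\<lambda>i. Suc (k * n + i)) ` {i. i < k \<and> P (Suc (k * n + i))}"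
proof -
  have "i \<in> (\<lambda>i. Suc (k * n + i)) ` {i. i < k \<and> P (Suc (k * n + i))}" if "i \<le> k * Suc n" "P i" "\<not> i \<le> k * n" for i
    using that by (intro image_eqI[of _ _ "i - Suc (k * n)"]) auto
  then show ?thesis by auto
qed

lemma card_ids_Suc:
  "card {i. i \<le> k * Suc n \<and> P i} = card {i. i \<le> k * n \<and> P i} + card {i. i < k \<and> P (Suc (k * n + i))}"
  unfolding ids_Suc
  by (subst card_Un_disjoint) (auto intro: finite_subset[of _ "{..k * n}"] card_image simp: inj_on_def)

lemma sum_ids_Suc:
  "(\<Sum>i\<le>k * Suc n. (w i :: real)) = (\<Sum>i\<le>k * n. w i) + (\<Sum>i<k. w (Suc (k * n + i)))"
proof -
  have "{..k * Suc n} = {..k * n} \<union> (\<lambda>i. Suc (k * n + i)) ` {..<k}"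
    using ids_Suc[of k n "\<lambda>_. True"] by (simp add: atMost_def lessThan_def)
  then show ?thesis
    by (simp only:) (subst sum.union_disjoint, auto simp: sum.reindex inj_on_def)
qed

lemma card_nth_notin:
  assumes "distinct xs" "e \<subseteq> set xs"
  shows "card {i. i < length xs \<and> xs ! i \<notin> e} = length xs - card e"
proof -
  have "bij_betw ((!) xs) {i. i < length xs \<and> xs ! i \<in> e} e"
    using assms by (auto simp: bij_betw_def inj_on_def nth_eq_iff_index_eq subset_iff in_set_conv_nth image_def)
  then have 1: "card {i. i < length xs \<and> xs ! i \<in> e} = card e"
    by (rule bij_betw_same_card)
  have "{i. i < length xs \<and> xs ! i \<notin> e} = {..<length xs} - {i. i < length xs \<and> xs ! i \<in> e}" by auto
  then have "card {i. i < length xs \<and> xs ! i \<notin> e} = card {..<length xs} - card {i. i < length xs \<and> xs ! i \<in> e}"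
    by (simp only:) (rule card_Diff_subset, auto)
  then show ?thesis using 1 by simp
qed

text \<open>A new clique contains \<open>e\<close> iff the chosen clique contains the rest of
  \<open>e\<close> and the replaced entry lies outside \<open>e\<close>. Removing
  \<open>k + length h\<close> treats sets with and without the new vertex at once.\<close>

lemma card_new_containing:
  "card {i. i < k \<and> e \<subseteq> set (clique_at k (c # h) (Suc (k * length h + i)))} =
   (if e - {k + length h} \<subseteq> set (clique_at k h c) then k - card (e - {k + length h}) else 0)"
proof -
  let ?e = "e - {k + length h}" and ?xs = "clique_at k h c"
  have "{i. i < k \<and> e \<subseteq> set (clique_at k (c # h) (Suc (k * length h + i)))} =
        {i. i < k \<and> ?e \<subseteq> set ?xs \<and> ?xs ! i \<notin> ?e}"
    using clique_at_less[of "k + length h" k h c] by (intro Collect_cong conj_cong refl, subst set_clique_at_new) auto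
  then show ?thesis using card_nth_notin[of ?xs ?e] by auto
qed

text \<open>This is the urn rule: a hit adds \<open>k - 2\<close> cliques around an edge and
  \<open>k - 1\<close> around a vertex.\<close>

lemma card_containing_Cons:
  assumes "k + length h \<notin> e"
  shows "card (containing k (c # h) e) = card (containing k h e) + (if e \<subseteq> set (clique_at k h c) then k - card e else 0)"
proof -
  have 1: "{i. i \<le> k * length h \<and> e \<subseteq> set (clique_at k (c # h) i)} = containing k h e"
    by (auto simp: containing_def)
  show ?thesis
    using card_ids_Suc[of k "length h" "\<lambda>i. e \<subseteq> set (clique_at k (c # h) i)"] card_new_containing[of k e c h] assms
    unfolding 1 by (simp add: containing_def[of k "c # h"])
qed

lemma card_containing_new:
  assumes "e \<subseteq> set (clique_at k h c)"
  shows "card (containing k (c # h) (insert (k + length h) e)) = k - card e"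
proof -
  let ?e = "insert (k + length h) e"
  have "{i. i \<le> k * length h \<and> ?e \<subseteq> set (clique_at k (c # h) i)} = {}"
    by (auto dest: clique_at_less)
  moreover have "?e - {k + length h} = e" using assms by (auto dest: clique_at_less)
  ultimately show ?thesis
    using card_ids_Suc[of k "length h" "\<lambda>i. ?e \<subseteq> set (clique_at k (c # h) i)"] card_new_containing[of k ?e c h] assms
    by (simp add: containing_def[of k "c # h"])
qed

lemma containing_mono_append: "card (containing k h e) \<le> card (containing k (g @ h) e)"
proof (induction g)
  case (Cons c g)
  have "containing k (g @ h) e \<subseteq> containing k (c # g @ h) e" by (auto simp: containing_def)
  then have "card (containing k (g @ h) e) \<le> card (containing k (c # g @ h) e)" by (intro card_mono) auto
  with Cons show ?case by simp
qed simp

section \<open>Edges, degrees and cliques of the generated graph\<close>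

lemma ktree_edge_less: "{u, v} \<in> ktree_of k h \<Longrightarrow> u < k + length h \<and> u \<noteq> v"
  by (induction h) (auto simp: complete_graph_def doubleton_eq_iff dest: clique_at_less)

lemma ktree_Cons_edge:
  "{u, w} \<in> ktree_of k (c # h) \<longleftrightarrow> {u, w} \<in> ktree_of k h \<or> u \<in> set (clique_at k h c) \<and> w = k + length h
     \<or> w \<in> set (clique_at k h c) \<and> u = k + length h"
  by (auto simp: doubleton_eq_iff)

lemma nbrs_new: "nbrs (ktree_of k (c # h)) (k + length h) = set (clique_at k h c)"
  using ktree_edge_less[of _ "k + length h" k h] ktree_edge_less[of "k + length h" _ k h]
  by (auto simp: nbrs_def ktree_Cons_edge insert_commute simp del: ktree_of.simps dest: clique_at_less)

lemma nbrs_old: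
  "w < k + length h \<Longrightarrow> nbrs (ktree_of k (c # h)) w = nbrs (ktree_of k h) w \<union> (if w \<in> set (clique_at k h c) then {k + length h} else {})"
  by (auto simp: nbrs_def ktree_Cons_edge simp del: ktree_of.simps)

lemma finite_nbrs [simp]: "finite (nbrs (ktree_of k h) w)"
  by (rule finite_subset[of _ "{..<k + length h}"]) (auto simp: nbrs_def dest: ktree_edge_less)

text \<open>Both counts start at \<open>k\<close>; each later attachment to \<open>k + t\<close>
  adds one neighbour but \<open>k - 1 \<ge> 1\<close> cliques. Thus an urn controls the degree.
  Initial vertices start in one clique with \<open>k - 1\<close> neighbours, hence the restriction
  to created ones.\<close>

lemma card_nbrs_le_containing:
  assumes "k \<ge> 2" "t < length h"
  shows "card (nbrs (ktree_of k h) (k + t)) \<le> card (containing k h {k + t})"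
  using assms(2)
proof (induction h)
  case (Cons c h)
  show ?case
  proof (cases "t < length h")
    case True
    have "card (nbrs (ktree_of k (c # h)) (k + t)) \<le> card (nbrs (ktree_of k h) (k + t)) + (if k + t \<in> set (clique_at k h c) then 1 else 0)"
      using True by (auto simp: nbrs_old card_insert_if simp del: ktree_of.simps)
    also have "\<dots> \<le> card (containing k h {k + t}) + (if k + t \<in> set (clique_at k h c) then k - 1 else 0)"
      using Cons True assms(1) by (intro add_mono) auto
    also have "\<dots> = card (containing k (c # h) {k + t})"
      using True by (subst card_containing_Cons) auto
    finally show ?thesis .
  next
    case False
    then have t: "t = length h" using Cons by simp
    show ?thesis
      using card_containing_new[of "{}" k h c] unfolding t by (simp add: nbrs_new distinct_card del: ktree_of.simps)
  qed
qed simp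

lemma clique_at_adjacent: "u \<in> set (clique_at k h i) \<Longrightarrow> v \<in> set (clique_at k h i) \<Longrightarrow> u \<noteq> v \<Longrightarrow> {u, v} \<in> ktree_of k h"
proof (induction h arbitrary: i u v)
  case Nil
  then show ?case by (auto simp: complete_graph_def)
next
  case (Cons c h)
  show ?case
  proof (cases "i \<le> k * length h")
    case True
    then show ?thesis using Cons by auto
  next
    case False
    have "set (clique_at k (c # h) i) \<subseteq> insert (k + length h) (set (clique_at k h c))"
      using False set_update_subset_insert by simp
    then show ?thesis using Cons.prems Cons.IH[of u c v] by (auto simp: ktree_Cons_edge simp del: ktree_of.simps clique_at.simps)
  qed
qed

text \<open>A \<open>k\<close>-clique through the newest vertex lies inside that vertex together
  with the chosen clique, which has \<open>k + 1\<close> elements, so it omits exactly one entry of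
  the chosen clique.\<close>

lemma kcliques_ktree_of:
  assumes "k \<ge> 1"
  shows "kcliques k (k + length h) (ktree_of k h) = (\<lambda>i. set (clique_at k h i)) ` {..k * length h}"
proof (induction h)
  case Nil
  have "S = {..<k}" if "S \<subseteq> {..<k}" "card S = k" for S
    using that by (simp add: card_subset_eq)
  then show ?case by (auto simp: kcliques_def complete_graph_def atLeast0LessThan)
next
  case (Cons c h)
  let ?v = "k + length h" and ?Q = "set (clique_at k h c)"
  have cardQ: "card ?Q = k" by (simp add: distinct_card)
  have "kcliques k (Suc ?v) (ktree_of k (c # h)) = kcliques k ?v (ktree_of k h) \<union> (\<lambda>i. insert ?v (?Q - {clique_at k h c ! i})) ` {..<k}"
    (is "?L = ?R1 \<union> ?R2")
  proof (intro equalityI subsetI)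
    fix S assume S: "S \<in> ?L"
    show "S \<in> ?R1 \<union> ?R2"
    proof (cases "?v \<in> S")
      case False
      then have "S \<subseteq> {..<?v}" using S by (fastforce simp: kcliques_def less_Suc_eq)
      moreover have "{u, w} \<in> ktree_of k h" if "u \<in> S" "w \<in> S" "u \<noteq> w" for u w
      proof -
        have "{u, w} \<in> ktree_of k (c # h)" using S that by (auto simp: kcliques_def simp del: ktree_of.simps)
        then show ?thesis using that False unfolding ktree_Cons_edge by auto
      qed
      ultimately show ?thesis using S by (auto simp: kcliques_def)
    next
      case True
      have sub: "S - {?v} \<subseteq> ?Q"
      proof
        fix u assume u: "u \<in> S - {?v}"
        then have "{u, ?v} \<in> ktree_of k (c # h)" using S True by (auto simp: kcliques_def simp del: ktree_of.simps)
        then show "u \<in> ?Q" using u ktree_edge_less[of ?v u k h] unfolding ktree_Cons_edge by (auto simp: insert_commute)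
      qed
      have fin: "finite S" using S by (auto simp: kcliques_def intro: finite_subset)
      have "card (S - {?v}) = k - 1" using True S fin by (simp add: kcliques_def)
      then have "card (?Q - (S - {?v})) = 1"
        using sub cardQ assms fin by (subst card_Diff_subset) auto
      then obtain x where x: "?Q - (S - {?v}) = {x}" by (auto simp: card_1_singleton_iff)
      then have xQ: "x \<in> ?Q" by auto
      then obtain i where i: "i < k" "clique_at k h c ! i = x" by (metis in_set_conv_nth length_clique_at)
      have "S = insert ?v (?Q - {x})" using True sub x by auto
      then show ?thesis using i by auto
    qed
  next
    fix S assume "S \<in> ?R1 \<union> ?R2"
    then show "S \<in> ?L"
    proof
      assume "S \<in> ?R1" then show ?thesis by (fastforce simp: kcliques_def)
    next
      assume "S \<in> ?R2"
      then obtain i where i: "i < k" and S: "S = insert ?v (?Q - {clique_at k h c ! i})" by auto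
      have Si: "S = set (clique_at k (c # h) (Suc (k * length h + i)))"
        unfolding S set_clique_at_new[OF i] ..
      show ?thesis
        unfolding kcliques_def Si
        using clique_at_adjacent[of _ k "c # h"] clique_at_less[of _ k "c # h" "Suc (k * length h + i)"]
        by (auto simp: distinct_card simp del: clique_at.simps ktree_of.simps)
    qed
  qed
  also have "?R2 = (\<lambda>i. set (clique_at k (c # h) (Suc (k * length h + i)))) ` {..<k}"
  proof (rule image_cong[OF refl])
    fix i assume "i \<in> {..<k}"
    then show "insert ?v (?Q - {clique_at k h c ! i}) = set (clique_at k (c # h) (Suc (k * length h + i)))"
      using set_clique_at_new[of i k c h] by simp
  qed
  also have "?R1 = (\<lambda>i. set (clique_at k (c # h) i)) ` {..k * length h}"
    unfolding Cons by (intro image_cong) auto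
  finally show ?case
    using ids_Suc[of k "length h" "\<lambda>_. True"]
    by (simp add: atMost_def lessThan_def image_Un image_image del: ktree_of.simps clique_at.simps)
qed

text \<open>Makes a uniform number a uniform clique. The newest vertex separates new cliques from
  old ones, and the omitted entry separates new ones from each other.\<close>

lemma inj_on_clique_at: "inj_on (\<lambda>i. set (clique_at k h i)) {..k * length h}"
proof (induction h)
  case (Cons c h)
  have eq: "{..k * length (c # h)} = {..k * length h} \<union> (\<lambda>i. Suc (k * length h + i)) ` {..<k}"
    using ids_Suc[of k "length h" "\<lambda>_. True"] by (simp add: atMost_def lessThan_def)
  have notin: "x \<notin> set (clique_at k h i)" if "x = k + length h" for x i using that by (auto dest: clique_at_less)
  show ?case
  proof (rule inj_onI)
    fix i j assume ij: "i \<in> {..k * length (c # h)}" "j \<in> {..k * length (c # h)}"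
      "set (clique_at k (c # h) i) = set (clique_at k (c # h) j)"
    have new: "\<exists>i'<k. i = Suc (k * length h + i')" if "i \<in> {..k * length (c # h)}" "\<not> i \<le> k * length h" for i
      using that unfolding eq by (elim UnE imageE) blast+
    have mem: "k + length h \<in> set (clique_at k (c # h) i) \<longleftrightarrow> \<not> i \<le> k * length h" if i: "i \<in> {..k * length (c # h)}" for i
    proof (cases "i \<le> k * length h")
      case True then show ?thesis using notin by simp
    next
      case False
      obtain i' where i': "i' < k" "i = Suc (k * length h + i')" using new[OF i False] by blast
      have "k + length h \<in> set (clique_at k (c # h) i)"
        unfolding i'(2) set_clique_at_new[OF i'(1)] by (rule insertI1)
      then show ?thesis using False by (simp only: not_False_eq_True)
    qed
    show "i = j"
    proof (cases "i \<le> k * length h")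
      case True
      then have "j \<le> k * length h" using mem[OF ij(1)] mem[OF ij(2)] ij(3) by blast
      then show ?thesis using True ij(3) Cons by (auto dest: inj_onD)
    next
      case False
      then have F2: "\<not> j \<le> k * length h" using mem[OF ij(1)] mem[OF ij(2)] ij(3) by blast
      obtain i' j' where i': "i' < k" "i = Suc (k * length h + i')" and j': "j' < k" "j = Suc (k * length h + j')"
        using new[OF ij(1) False] new[OF ij(2) F2] by blast
      have "insert (k + length h) (set (clique_at k h c) - {clique_at k h c ! i'}) = insert (k + length h) (set (clique_at k h c) - {clique_at k h c ! j'})"
        using ij(3) unfolding i'(2) j'(2) set_clique_at_new[OF i'(1)] set_clique_at_new[OF j'(1)] .
      then have "set (clique_at k h c) - {clique_at k h c ! i'} = set (clique_at k h c) - {clique_at k h c ! j'}"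
        using notin[of "k + length h" c] by (subst (asm) insert_ident) auto
      moreover have "clique_at k h c ! i' \<in> set (clique_at k h c)" "clique_at k h c ! j' \<in> set (clique_at k h c)" using i' j' by auto
      ultimately have "clique_at k h c ! i' = clique_at k h c ! j'" by blast
      then show ?thesis using i' j' distinct_clique_at[of k h c] by (simp add: nth_eq_iff_index_eq)
    qed
  qed
qed auto

section \<open>The process as a sequence of uniform clique numbers\<close>

primrec history :: "nat \<Rightarrow> nat \<Rightarrow> nat list pmf" where
  "history k 0 = return_pmf []"
| "history k (Suc t) = bind_pmf (history k t) (\<lambda>h. map_pmf (\<lambda>c. c # h) (pmf_of_set {..k * t}))"

lemma length_history: "h \<in> set_pmf (history k t) \<Longrightarrow> length h = t"
  by (induction t arbitrary: h) auto

lemma random_ktree_history: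
  assumes "k \<ge> 1" shows "random_ktree k t = map_pmf (ktree_of k) (history k t)"
proof (induction t)
  case (Suc t)
  have "random_ktree k (Suc t) = bind_pmf (history k t) (\<lambda>h. ktree_step k t (ktree_of k h))"
    by (simp add: Suc bind_map_pmf)
  also have "\<dots> = bind_pmf (history k t) (\<lambda>h. map_pmf (\<lambda>c. ktree_of k (c # h)) (pmf_of_set {..k * t}))"
  proof (rule bind_pmf_cong[OF refl])
    fix h assume "h \<in> set_pmf (history k t)"
    then have t: "t = length h" by (simp add: length_history)
    have "pmf_of_set (kcliques k (k + t) (ktree_of k h)) = map_pmf (\<lambda>i. set (clique_at k h i)) (pmf_of_set {..k * t})"
      unfolding t kcliques_ktree_of[OF assms] by (intro map_pmf_of_set_inj[symmetric] inj_on_clique_at) auto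
    then show "ktree_step k t (ktree_of k h) = map_pmf (\<lambda>c. ktree_of k (c # h)) (pmf_of_set {..k * t})"
      by (simp add: ktree_step_def map_pmf_comp t)
  qed
  also have "\<dots> = map_pmf (ktree_of k) (history k (Suc t))"
    by (simp add: map_bind_pmf map_pmf_comp del: ktree_of.simps)
  finally show ?case .
qed simp

section \<open>The path towards vertex \<open>0\<close>\<close>

lemma newest_in_clique: "k \<ge> 1 \<Longrightarrow> newest k h i \<in> set (clique_at k h i)"
proof (induction h arbitrary: i)
  case (Cons c h)
  show ?case
  proof (cases "i \<le> k * length h")
    case False
    obtain j where "set (clique_at k (c # h) i) = insert (k + length h) (set (clique_at k h c) - {clique_at k h c ! j})"
      using set_clique_at_new'[OF Cons.prems False] by metis
    then show ?thesis using False by (simp del: clique_at.simps)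
  qed (use Cons in auto)
qed auto

lemma newest_less: "k \<ge> 1 \<Longrightarrow> newest k h i < k + length h"
  using newest_in_clique clique_at_less by blast

lemma parent_append: "t < length h \<Longrightarrow> parent k (g @ h) t = parent k h t"
  by (induction g) auto

lemma chain_less: "t \<in> set (chain k h i) \<Longrightarrow> t < length h"
  by (induction h arbitrary: i) (auto split: if_splits simp: less_Suc_eq)

lemma new_id_bounds: "k \<ge> 1 \<Longrightarrow> t < length h \<Longrightarrow> Suc (k * t) \<le> k * length h"
proof -
  assume "k \<ge> 1" "t < length h"
  then have "k * Suc t \<le> k * length h" by (intro mult_le_mono2) simp
  then show ?thesis using \<open>k \<ge> 1\<close> by simp
qed

text \<open>\<open>Suc (k * t)\<close>, the first number issued at step \<open>t\<close>, stands for
  the vertex \<open>k + t\<close> from here on: the chain of this clique is the path of that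
  vertex.\<close>

lemma newest_new_id: "k \<ge> 1 \<Longrightarrow> t < length h \<Longrightarrow> newest k h (Suc (k * t)) = k + t"
proof (induction h)
  case (Cons c h)
  then show ?case using new_id_bounds[of k t h] by (auto simp: less_Suc_eq)
qed simp

lemma parent_less: "k \<ge> 1 \<Longrightarrow> t < length h \<Longrightarrow> parent k h t < k + t"
  by (induction h) (auto simp: less_Suc_eq newest_less)

lemma parent_edge:
  assumes "k \<ge> 1" "t < length h" shows "{k + t, parent k h t} \<in> ktree_of k h"
  using assms(2)
proof (induction h)
  case (Cons c h)
  then show ?case using assms(1)
    by (cases "t < length h") (auto simp: less_Suc_eq newest_in_clique insert_commute)
qed simp

text \<open>Of the \<open>k\<close> cliques created together with \<open>k + t\<close>, all but one
  keep its parent. They are the initial balls of the urn that belongs to this edge.\<close>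

lemma card_containing_parent:
  assumes "k \<ge> 1" "t < length h" shows "k - 1 \<le> card (containing k h {k + t, parent k h t})"
  using assms(2)
proof (induction h)
  case (Cons c h)
  show ?case
  proof (cases "t < length h")
    case True
    then show ?thesis
      using Cons containing_mono_append[of k h "{k + t, parent k h t}" "[c]"] by (auto intro: order_trans)
  next
    case False
    then show ?thesis
      using Cons card_containing_new[of "{newest k h c}" k h c] newest_in_clique[OF assms(1), of h c] by (simp add: less_Suc_eq)
  qed
qed simp

lemma walk_chain:
  assumes "k \<ge> 1" "\<And>t. t \<in> set (chain k h i) \<Longrightarrow> walk G M (k + t) (parent k h t) (\<kappa> t)"
  shows "walk G M (newest k h i) 0 (\<Sum>t\<leftarrow>chain k h i. \<kappa> t)"
  using assms(2)
proof (induction h arbitrary: i)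
  case Nil
  then show ?case by (simp add: walk.stay)
next
  case (Cons c h)
  have *: "walk G M (newest k h i') 0 (\<Sum>t\<leftarrow>chain k h i'. \<kappa> t)" if "set (chain k h i') \<subseteq> set (chain k (c # h) i)" for i'
  proof (rule Cons.IH)
    fix t assume t: "t \<in> set (chain k h i')"
    then show "walk G M (k + t) (parent k h t) (\<kappa> t)"
      using Cons.prems[of t] that chain_less[OF t] by auto
  qed
  show ?case
  proof (cases "i \<le> k * length h")
    case True
    then show ?thesis using *[of i] by auto
  next
    case False
    then show ?thesis
      using Cons.prems[of "length h"] *[of c] by (auto intro: walk_trans)
  qed
qed

section \<open>Pieces hanging off the cliques at time \<open>m\<close>\<close>

lemma piece_of_short: "length h \<le> m \<Longrightarrow> piece_of k m h i = i"
  by (induction h arbitrary: i) auto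

text \<open>The part of a path before \<open>m\<close> depends on the later choices \<open>g\<close>
  only through the piece. Given \<open>h\<close>, there is thus one early path per clique at time
  \<open>m\<close>.\<close>

lemma filter_chain:
  "length h = m \<Longrightarrow> filter (\<lambda>t. t < m) (chain k (g @ h) i) = chain k h (piece_of k m (g @ h) i)"
proof (induction g arbitrary: i)
  case Nil
  then show ?case by (auto simp: piece_of_short filter_id_conv dest: chain_less)
qed auto

text \<open>All late cliques on a path descend from the same clique at time \<open>m\<close>, so a
  single piece size bounds the degrees of all late vertices of the path.\<close>

lemma piece_of_chain:
  "k \<ge> 1 \<Longrightarrow> t \<in> set (chain k h i) \<Longrightarrow> m \<le> t \<Longrightarrow> piece_of k m h i = piece_of k m h (Suc (k * t))"
proof (induction h arbitrary: i)
  case (Cons c h)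
  show ?case
  proof (cases "t < length h")
    case True
    then show ?thesis using Cons new_id_bounds[of k t h] by (auto split: if_splits)
  next
    case False
    then have "t = length h" using Cons.prems chain_less[of t k "c # h" i] by simp
    then show ?thesis using Cons by (auto split: if_splits dest: chain_less)
  qed
qed simp

text \<open>A clique through \<open>k + t\<close> is created either together with this vertex or by
  attaching to an older clique through it, so all of them share one ancestor at time
  \<open>m\<close>.\<close>

lemma piece_of_clique:
  "k \<ge> 1 \<Longrightarrow> k + t \<in> set (clique_at k h i) \<Longrightarrow> m \<le> t \<Longrightarrow> piece_of k m h i = piece_of k m h (Suc (k * t))"
proof (induction h arbitrary: i)
  case (Cons c h)
  have tl: "t < Suc (length h)" using clique_at_less[OF Cons.prems(2)] by simp
  show ?case
  proof (cases "i \<le> k * length h")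
    case True
    then have "k + t \<in> set (clique_at k h i)" using Cons by simp
    then show ?thesis using Cons True clique_at_less[of "k + t" k h i] new_id_bounds[of k t h] by auto
  next
    case False
    obtain j where "set (clique_at k (c # h) i) = insert (k + length h) (set (clique_at k h c) - {clique_at k h c ! j})"
      using set_clique_at_new'[OF Cons.prems(1) False] by metis
    then have "t = length h \<or> k + t \<in> set (clique_at k h c)" using Cons.prems(2) by auto
    then show ?thesis
    proof
      assume "t = length h" then show ?thesis using False Cons.prems by auto
    next
      assume a: "k + t \<in> set (clique_at k h c)"
      then show ?thesis using Cons.IH[OF Cons.prems(1) a] False Cons.prems tl clique_at_less[OF a]
        new_id_bounds[of k t h] by auto
    qed
  qed
qed simp

lemma containing_subset_piece:
  assumes "k \<ge> 1" "m \<le> t" shows "containing k h {k + t} \<subseteq> piece k m h (piece_of k m h (Suc (k * t)))"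
  using piece_of_clique[OF assms(1) _ assms(2)] by (auto simp: containing_def piece_def)

lemma first_hub_None: "length h \<le> s \<Longrightarrow> first_hub k s e h = None"
  by (induction h) auto

lemma first_hub_SomeD:
  "first_hub k s e h = Some w \<Longrightarrow> \<exists>t. w = k + t \<and> s \<le> t \<and> t < length h \<and> (\<forall>u\<in>e. {u, w} \<in> ktree_of k h)"
proof (induction h)
  case (Cons c h)
  show ?case
  proof (cases "first_hub k s e h")
    case None
    then show ?thesis using Cons.prems by (auto split: if_splits)
  next
    case (Some w')
    then show ?thesis using Cons by (auto simp: less_Suc_eq)
  qed
qed simp

lemma piece_Cons:
  assumes "m \<le> length h"
  shows "card (piece k m (c # h) A) = card (piece k m h A) + (if piece_of k m h c = A then k else 0)"
proof -
  have "{i. i \<le> k * length h \<and> piece_of k m (c # h) i = A} = piece k m h A" by (auto simp: piece_def)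
  moreover have "{i. i < k \<and> piece_of k m (c # h) (Suc (k * length h + i)) = A} = (if piece_of k m h c = A then {..<k} else {})"
    using assms by auto
  ultimately show ?thesis
    using card_ids_Suc[of k "length h" "\<lambda>i. piece_of k m (c # h) i = A"] by (simp add: piece_def[of k m "c # h"])
qed

text \<open>Every choice refers to a clique existing at that time. This keeps ancestors at time
  \<open>m\<close> among the \<open>k * m + 1\<close> cliques of that time, so that the pieces
  partition all cliques.\<close>

definition valid :: "nat \<Rightarrow> nat list \<Rightarrow> bool" where
  "valid k h \<longleftrightarrow> (\<forall>g c h'. h = g @ c # h' \<longrightarrow> c \<le> k * length h')"

lemma valid_Nil [simp]: "valid k []" by (simp add: valid_def)

lemma valid_Cons [simp]: "valid k (c # h) \<longleftrightarrow> c \<le> k * length h \<and> valid k h"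
  unfolding valid_def by (auto simp: Cons_eq_append_conv)

lemma piece_of_le: "valid k h \<Longrightarrow> m \<le> length h \<Longrightarrow> i \<le> k * length h \<Longrightarrow> piece_of k m h i \<le> k * m"
proof (induction h arbitrary: i)
  case (Cons c h)
  then show ?case
    by (cases "m = Suc (length h)") (auto simp: piece_of_short)
qed simp

lemma card_ids_piece_of:
  assumes "valid k h" "m \<le> length h"
  shows "card {i. i \<le> k * length h \<and> P (piece_of k m h i)} = (\<Sum>A | A \<le> k * m \<and> P A. card (piece k m h A))"
proof -
  have "{i. i \<le> k * length h \<and> P (piece_of k m h i)} = (\<Union>A\<in>{A. A \<le> k * m \<and> P A}. piece k m h A)"
    using piece_of_le[OF assms] by (auto simp: piece_def)
  then show ?thesis
    by (simp only:) (subst card_UN_disjoint, auto simp: piece_def)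
qed

section \<open>Averages over the random choices\<close>

text \<open>\<open>(avg k ^^ d) \<Phi> h\<close> is the conditional expectation of \<open>\<Phi>\<close> after \<open>d\<close> further steps from \<open>h\<close>.\<close>
definition avg :: "nat \<Rightarrow> (nat list \<Rightarrow> real) \<Rightarrow> nat list \<Rightarrow> real" where
  "avg k \<Phi> h = (\<Sum>c\<le>k * length h. \<Phi> (c # h)) / real (k * length h + 1)"

lemma avg_lin: "avg k (\<lambda>h. a * \<Phi> h + b * \<Psi> h) = (\<lambda>h. a * avg k \<Phi> h + b * avg k \<Psi> h)"
  by (simp add: avg_def fun_eq_iff sum.distrib sum_distrib_left[symmetric] add_divide_distrib)

lemma avg_pow_lin: "(avg k ^^ d) (\<lambda>h. a * \<Phi> h + b * \<Psi> h) h = a * (avg k ^^ d) \<Phi> h + b * (avg k ^^ d) \<Psi> h"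
proof (induction d arbitrary: h)
  case (Suc d)
  then have "(avg k ^^ d) (\<lambda>h. a * \<Phi> h + b * \<Psi> h) = (\<lambda>h. a * (avg k ^^ d) \<Phi> h + b * (avg k ^^ d) \<Psi> h)"
    by (simp add: fun_eq_iff)
  then show ?case by (simp add: avg_lin)
qed simp

lemma avg_pow_add: "(avg k ^^ d) (\<lambda>h. \<Phi> h + \<Psi> h) h = (avg k ^^ d) \<Phi> h + (avg k ^^ d) \<Psi> h"
  using avg_pow_lin[of d k 1 \<Phi> 1 \<Psi> h] by simp

lemma avg_pow_cmult: "(avg k ^^ d) (\<lambda>h. a * \<Phi> h) h = a * (avg k ^^ d) \<Phi> h"
  using avg_pow_lin[of d k a \<Phi> 0 \<Phi> h] by simp

lemma avg_const: "avg k (\<lambda>h. a) = (\<lambda>h. a)"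
  by (simp add: avg_def fun_eq_iff del: of_nat_add of_nat_Suc)

lemma avg_pow_const: "(avg k ^^ d) (\<lambda>h. a) h = a"
  by (induction d arbitrary: h) (auto simp: avg_const funpow_swap1)

lemma avg_pow_sum: "(avg k ^^ d) (\<lambda>h. \<Sum>i\<in>I. \<Phi> i h) h = (\<Sum>i\<in>I. (avg k ^^ d) (\<Phi> i) h)"
proof (induction I rule: infinite_finite_induct)
  case (insert x F)
  then show ?case using avg_pow_add[of d k "\<Phi> x" "\<lambda>h. \<Sum>i\<in>F. \<Phi> i h" h] by simp
qed (auto simp: avg_pow_const)

lemma avg_pow_mono:
  assumes "\<And>g. length g = d \<Longrightarrow> valid k (g @ h) \<Longrightarrow> \<Phi> (g @ h) \<le> \<Psi> (g @ h)" "valid k h"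
  shows "(avg k ^^ d) \<Phi> h \<le> (avg k ^^ d) \<Psi> h"
  using assms
proof (induction d arbitrary: h)
  case 0
  then show ?case by simp
next
  case (Suc d)
  have "(avg k ^^ d) \<Phi> (c # h) \<le> (avg k ^^ d) \<Psi> (c # h)" if "c \<le> k * length h" for c
    using Suc.prems(1)[of "_ @ [c]"] Suc.prems(2) that by (intro Suc.IH) auto
  then show ?case
    unfolding funpow.simps comp_apply avg_def[of k "(avg k ^^ d) \<Phi>"] avg_def[of k "(avg k ^^ d) \<Psi>"]
    by (intro divide_right_mono sum_mono) auto
qed

text \<open>\<open>\<Phi> t / g t\<close> is a supermartingale, with \<open>g\<close> a
  deterministic growth rate. The last step is averaged first, where the one-step hypothesis applies
  pointwise.\<close>

lemma avg_pow_supermartingale: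
  assumes "\<And>t h. m \<le> t \<Longrightarrow> t < n \<Longrightarrow> length h = t \<Longrightarrow> avg k (\<Phi> (Suc t)) h \<le> g (Suc t) / g t * \<Phi> t h"
    and "\<And>t. m \<le> t \<Longrightarrow> (g t :: real) > 0"
    and "length h = m" "m \<le> n" "valid k h"
  shows "(avg k ^^ (n - m)) (\<Phi> n) h \<le> g n / g m * \<Phi> m h"
  using assms(4,1)
proof (induction rule: dec_induct)
  case base
  then show ?case using assms(2)[of m] by simp
next
  case (step n)
  have "(avg k ^^ (Suc n - m)) (\<Phi> (Suc n)) h = (avg k ^^ (n - m)) (avg k (\<Phi> (Suc n))) h"
    using step by (simp add: Suc_diff_le funpow_swap1)
  also have "\<dots> \<le> (avg k ^^ (n - m)) (\<lambda>h. g (Suc n) / g n * \<Phi> n h) h"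
    using step assms(3,5) by (intro avg_pow_mono) auto
  also have "\<dots> = g (Suc n) / g n * (avg k ^^ (n - m)) (\<Phi> n) h"
    by (rule avg_pow_cmult)
  also have "\<dots> \<le> g (Suc n) / g n * (g n / g m * \<Phi> m h)"
    using step assms(2)[of n] assms(2)[of "Suc n"] by (intro mult_left_mono step.IH) auto
  also have "\<dots> = g (Suc n) / g m * \<Phi> m h"
    using step assms(2)[of n] by simp
  finally show ?case .
qed

lemma avg_urn:
  assumes "V \<subseteq> {..k * length h}" "\<And>c. c \<le> k * length h \<Longrightarrow> \<Phi> (c # h) = (if c \<in> V then a else b)"
  shows "avg k \<Phi> h = b + real (card V) / real (k * length h + 1) * (a - b)"
proof -
  have fin: "finite V" using assms(1) by (rule finite_subset) simp
  have "(\<Sum>c\<le>k * length h. \<Phi> (c # h)) = (\<Sum>c\<le>k * length h. b + (if c \<in> V then a - b else 0))"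
    using assms(2) by (intro sum.cong) auto
  also have "\<dots> = real (k * length h + 1) * b + real (card V) * (a - b)"
    using assms(1) fin by (simp add: sum.distrib sum.If_cases Int_absorb1 add.commute)
  finally show ?thesis
    by (simp add: avg_def add_divide_distrib del: of_nat_add of_nat_mult of_nat_Suc)
qed

text \<open>Rising factorials with step \<open>a\<close>: for a Polya urn gaining \<open>a\<close> balls per hit they are, up to
  normalisation, martingales, and so give all moments of the urn exactly.\<close>
definition rising :: "real \<Rightarrow> nat \<Rightarrow> real \<Rightarrow> real" where
  "rising a j x = (\<Prod>i<j. x + real i * a)"

text \<open>Both sides are the product of \<open>x\<close>, \<open>x + a\<close>, ...,
  \<open>x + j * a\<close>.\<close>

lemma rising_shift: "x * rising a j (x + a) = rising a j x * (x + real j * a)"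
proof (induction j)
  case (Suc j)
  have "x * rising a (Suc j) (x + a) = (x * rising a j (x + a)) * (x + a + real j * a)"
    by (simp add: rising_def)
  also have "\<dots> = rising a (Suc j) x * (x + real (Suc j) * a)"
    unfolding Suc by (simp add: rising_def algebra_simps)
  finally show ?case .
qed (simp add: rising_def)

lemma rising_nonneg: "0 \<le> a \<Longrightarrow> 0 \<le> x \<Longrightarrow> 0 \<le> rising a j x"
  by (auto simp: rising_def intro!: prod_nonneg)

lemma rising_ge_power: "0 \<le> a \<Longrightarrow> 0 \<le> y \<Longrightarrow> y \<le> x \<Longrightarrow> y ^ j \<le> rising a j x"
proof (induction j)
  case (Suc j)
  have "y ^ j * y \<le> rising a j x * (x + real j * a)"
  proof (rule mult_mono)
    show "y \<le> x + real j * a" using Suc.prems by (intro add_increasing2) auto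
  qed (use Suc in \<open>auto intro!: rising_nonneg\<close>)
  then show ?case by (simp add: rising_def mult.commute)
qed (simp add: rising_def)

text \<open>A hit is proportional to the urn size, and by \<open>rising_shift\<close> the size times
  the increase is exactly \<open>j * a\<close> times the old value. So averaging multiplies by a
  deterministic factor.\<close>

lemma avg_rising:
  assumes "\<And>c. c \<le> k * length h \<Longrightarrow> card (V (c # h)) = card (V h) + (if c \<in> V h then a else 0)"
    and "V h \<subseteq> {..k * length h}"
  shows "avg k (\<lambda>h. rising (real a) j (real (card (V h)))) h
    = (1 + real j * real a / real (k * length h + 1)) * rising (real a) j (real (card (V h)))"
proof -
  let ?x = "real (card (V h))" and ?n = "real (k * length h + 1)"
  have "avg k (\<lambda>h. rising (real a) j (real (card (V h)))) h = rising a j ?x + ?x / ?n * (rising a j (?x + a) - rising a j ?x)"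
    by (rule avg_urn[OF assms(2)]) (use assms(1) in auto)
  also have "?x / ?n * (rising a j (?x + a) - rising a j ?x) = (?x * rising a j (?x + a) - ?x * rising a j ?x) / ?n"
    by (simp add: right_diff_distrib diff_divide_distrib del: of_nat_add of_nat_mult of_nat_Suc)
  also have "?x * rising a j (?x + a) - ?x * rising a j ?x = real j * real a * rising a j ?x"
    unfolding rising_shift by (simp add: algebra_simps)
  finally show ?thesis by (simp add: algebra_simps del: of_nat_add of_nat_mult of_nat_Suc)
qed

section \<open>Second moments of pieces and exponential moments of path lengths\<close>

lemma growth_sq:
  assumes "t \<ge> 1" "k \<ge> 1" shows "1 + 2 * real k / real (k * t + 1) \<le> (real (Suc t))\<^sup>2 / (real t)\<^sup>2"
proof -
  have "2 * real k / real (k * t + 1) \<le> 2 * real k / real (k * t)"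
    using assms by (intro divide_left_mono mult_pos_pos) (auto simp del: of_nat_add of_nat_Suc of_nat_mult)
  also have "\<dots> = 2 / real t" using assms by simp
  finally have "1 + 2 * real k / real (k * t + 1) \<le> (1 + 1 / real t)\<^sup>2"
    by (simp add: power2_eq_square algebra_simps add_increasing2)
  also have "\<dots> = (real (Suc t))\<^sup>2 / (real t)\<^sup>2"
    using assms by (simp add: power2_eq_square field_simps)
  finally show ?thesis .
qed

text \<open>A piece starts as the single clique \<open>A\<close> and gains \<open>k\<close> per hit.
  The rising factorial \<open>x * (x + k)\<close> dominates the square, starts at
  \<open>k + 1\<close> and grows at most quadratically in time.\<close>

lemma avg_piece_sq:
  assumes "k \<ge> 1" "m \<ge> 1" "m \<le> n" "length h = m" "valid k h" "A \<le> k * m"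
  shows "(avg k ^^ (n - m)) (\<lambda>h. (real (card (piece k m h A)))\<^sup>2) h \<le> real (Suc k) * (real n / real m)\<^sup>2"
proof -
  have "(avg k ^^ (n - m)) (\<lambda>h. (real (card (piece k m h A)))\<^sup>2) h
      \<le> (avg k ^^ (n - m)) (\<lambda>h. rising (real k) 2 (real (card (piece k m h A)))) h"
    by (intro avg_pow_mono assms rising_ge_power) auto
  also have "\<dots> \<le> (real n)\<^sup>2 / (real m)\<^sup>2 * rising (real k) 2 (real (card (piece k m h A)))"
  proof (rule avg_pow_supermartingale[where \<Phi> = "\<lambda>_ h. rising (real k) 2 (real (card (piece k m h A)))" and g = "\<lambda>t. (real t)\<^sup>2"])
    fix t h assume t: "m \<le> t" "length (h::nat list) = t"
    have "avg k (\<lambda>h. rising (real k) 2 (real (card (piece k m h A)))) h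
        = (1 + real 2 * real k / real (k * length h + 1)) * rising (real k) 2 (real (card (piece k m h A)))"
    proof (rule avg_rising)
      show "card (piece k m (c # h) A) = card (piece k m h A) + (if c \<in> piece k m h A then k else 0)"
        if "c \<le> k * length h" for c
        using t that by (subst piece_Cons) (auto simp: piece_def)
    qed (auto simp: piece_def)
    also have "\<dots> \<le> (real (Suc t))\<^sup>2 / (real t)\<^sup>2 * rising (real k) 2 (real (card (piece k m h A)))"
      using growth_sq[of t k] t assms by (intro mult_right_mono rising_nonneg) auto
    finally show "avg k (\<lambda>h. rising (real k) 2 (real (card (piece k m h A)))) h \<le> \<dots>" .
  qed (use assms in auto)
  also have "piece k m h A = {A}"
    using assms by (auto simp: piece_def piece_of_short)
  finally show ?thesis
    by (simp add: rising_def numeral_2_eq_2 power_divide mult.commute)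
qed

text \<open>An exponential moment of the path lengths after \<open>m\<close>. Choosing a clique
  creates \<open>k\<close> cliques of twice its weight, so the mean total grows only quadratically
  in time, and Markov's inequality gives logarithmic lengths.\<close>

definition depth_weight :: "nat \<Rightarrow> nat \<Rightarrow> nat list \<Rightarrow> real" where
  "depth_weight k m h = (\<Sum>i\<le>k * length h. 2 ^ length (filter (\<lambda>t. m \<le> t) (chain k h i)))"

lemma avg_depth_weight:
  assumes "m \<le> length h" shows "avg k (depth_weight k m) h = (1 + 2 * real k / real (k * length h + 1)) * depth_weight k m h"
proof -
  have "depth_weight k m (c # h) = depth_weight k m h + real k * (2 * 2 ^ length (filter (\<lambda>t. m \<le> t) (chain k h c)))" for c
    using assms unfolding depth_weight_def by (simp add: sum_ids_Suc del: mult_Suc_right)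
  then have "(\<Sum>c\<le>k * length h. depth_weight k m (c # h)) = real (k * length h + 1) * depth_weight k m h + 2 * real k * depth_weight k m h"
    by (simp add: sum.distrib depth_weight_def sum_distrib_left algebra_simps)
  then show ?thesis
    by (simp add: avg_def add_divide_distrib distrib_right del: of_nat_add of_nat_mult of_nat_Suc)
qed

lemma depth_weight_nonneg: "0 \<le> depth_weight k m h" by (auto simp: depth_weight_def intro!: sum_nonneg)

lemma avg_pow_depth_weight:
  assumes "k \<ge> 1" "m \<ge> 1" "m \<le> n" "length h = m" "valid k h"
  shows "(avg k ^^ (n - m)) (depth_weight k m) h \<le> real (k * m + 1) * (real n / real m)\<^sup>2"
proof -
  have "(avg k ^^ (n - m)) (depth_weight k m) h \<le> (real n)\<^sup>2 / (real m)\<^sup>2 * depth_weight k m h"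
  proof (rule avg_pow_supermartingale[where \<Phi> = "\<lambda>_. depth_weight k m" and g = "\<lambda>t. (real t)\<^sup>2"])
    fix t h assume t: "m \<le> t" "length (h::nat list) = t"
    have "avg k (depth_weight k m) h = (1 + 2 * real k / real (k * t + 1)) * depth_weight k m h"
      using t by (simp only: avg_depth_weight)
    also have "\<dots> \<le> (real (Suc t))\<^sup>2 / (real t)\<^sup>2 * depth_weight k m h"
      using growth_sq[of t k] assms t by (intro mult_right_mono depth_weight_nonneg) auto
    finally show "avg k (depth_weight k m) h \<le> (real (Suc t))\<^sup>2 / (real t)\<^sup>2 * depth_weight k m h" .
  qed (use assms in auto)
  also have "filter (\<lambda>t. m \<le> t) (chain k h i) = []" for i
    using assms by (auto simp: filter_empty_conv dest: chain_less)
  then have "depth_weight k m h = real (k * m + 1)" using assms by (simp add: depth_weight_def)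
  finally show ?thesis by (simp add: power_divide mult.commute)
qed

lemma avg_pow_depth_weight0:
  assumes "k \<ge> 1" "m \<ge> 1"
  shows "(avg k ^^ m) (depth_weight k 0) [] \<le> (1 + 2 * real k) * (real m)\<^sup>2"
proof -
  \<comment> \<open>The quadratic rate vanishes at time \<open>0\<close>; the value there matches
    the first growth factor \<open>1 + 2 * k\<close>.\<close>
  let ?g = "\<lambda>t. if t = 0 then 1 / (1 + 2 * real k) else (real t)\<^sup>2"
  have "(avg k ^^ (m - 0)) (depth_weight k 0) [] \<le> ?g m / ?g 0 * depth_weight k 0 []"
  proof (rule avg_pow_supermartingale[where \<Phi> = "\<lambda>_. depth_weight k 0"])
    fix t h assume t: "length (h::nat list) = t"
    have "avg k (depth_weight k 0) h = (1 + 2 * real k / real (k * t + 1)) * depth_weight k 0 h"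
      using t by (simp only: avg_depth_weight)
    also have "\<dots> \<le> ?g (Suc t) / ?g t * depth_weight k 0 h"
    proof (intro mult_right_mono depth_weight_nonneg)
      show "1 + 2 * real k / real (k * t + 1) \<le> ?g (Suc t) / ?g t"
        using growth_sq[of t k] assms by (cases "t = 0") auto
    qed
    finally show "avg k (depth_weight k 0) h \<le> ?g (Suc t) / ?g t * depth_weight k 0 h" .
  qed (use assms in \<open>auto simp: add_pos_nonneg\<close>)
  then show ?thesis using assms by (simp add: depth_weight_def mult.commute)
qed

section \<open>Iterated averages as expectations\<close>

lemma integral_bind_pmf_finite:
  fixes g :: "'b \<Rightarrow> real"
  assumes "finite (set_pmf p)" "\<And>x. x \<in> set_pmf p \<Longrightarrow> finite (set_pmf (f x))"
  shows "measure_pmf.expectation (bind_pmf p f) g = measure_pmf.expectation p (\<lambda>x. measure_pmf.expectation (f x) g)"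
  using assms
  using integral_measure_pmf_real[of "set_pmf p" p "\<lambda>x. measure_pmf.expectation (f x) g"]
  by (subst pmf_expectation_bind[of "set_pmf p"]) (auto simp: mult.commute)

lemma finite_set_history [simp]: "finite (set_pmf (history k t))"
  by (induction t) auto

lemma expectation_history: "measure_pmf.expectation (history k t) \<Phi> = (avg k ^^ t) \<Phi> []"
proof (induction t arbitrary: \<Phi>)
  case (Suc t)
  have "measure_pmf.expectation (history k (Suc t)) \<Phi> = measure_pmf.expectation (history k t) (avg k \<Phi>)"
  proof -
    have "measure_pmf.expectation (map_pmf (\<lambda>c. c # h) (pmf_of_set {..k * t})) \<Phi> = avg k \<Phi> h"
      if "h \<in> set_pmf (history k t)" for h
      using length_history[OF that] by (simp add: integral_pmf_of_set avg_def)
    then show ?thesis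
      unfolding history.simps by (subst integral_bind_pmf_finite) (auto intro!: integral_cong_AE AE_pmfI)
  qed
  then show ?case using Suc by (simp add: funpow_swap1)
qed simp

section \<open>Edges without a good hub\<close>

text \<open>With \<open>X\<close> the number of cliques containing \<open>e\<close>, the quantity \<open>z t ^ X\<close> is a supermartingale as long
  as no hub has appeared. Before time \<open>s\<close> a hit only increases \<open>X\<close> by \<open>k - 2\<close> (condition \<open>z1\<close>),
  afterwards it ends the process (condition \<open>z2\<close>); both rest on Bernoulli's inequality.\<close>
lemma avg_first_hub_None:
  assumes "k \<ge> 2" "e \<subseteq> {..<k + m}" "card e = 2" "m \<le> s" "s \<le> n" "length h = m" "valid k h"
    and z: "\<And>t. 0 < z t" "\<And>t. z t \<le> (1::real)" "z n = 1"
    and z1: "\<And>t. m \<le> t \<Longrightarrow> t < s \<Longrightarrow> z (Suc t) * (1 - (1 - z (Suc t) ^ (k - 2)) / real (k * t + 1)) \<le> z t"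
    and z2: "\<And>t. s \<le> t \<Longrightarrow> t < n \<Longrightarrow> z (Suc t) * (1 - 1 / real (k * t + 1)) \<le> z t"
  shows "(avg k ^^ (n - m)) (\<lambda>h. of_bool (first_hub k s e h = None)) h \<le> z m ^ card (containing k h e)"
proof -
  let ?\<Phi> = "\<lambda>t h. of_bool (first_hub k s e h = None) * z t ^ card (containing k h e)"
  have "(avg k ^^ (n - m)) (?\<Phi> n) h \<le> 1 / 1 * ?\<Phi> m h"
  proof (rule avg_pow_supermartingale[where g = "\<lambda>_. 1" and \<Phi> = ?\<Phi>])
    fix t h assume t: "m \<le> t" "t < n" "length (h::nat list) = t"
    let ?N = "real (k * length h + 1)" and ?X = "card (containing k h e)" and ?z = "z (Suc t)"
    have notin: "k + length h \<notin> e" using assms(2) t by auto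
    have sub: "containing k h e \<subseteq> {..k * length h}" by (auto simp: containing_def)
    have inU: "c \<in> containing k h e \<longleftrightarrow> e \<subseteq> set (clique_at k h c)" if "c \<le> k * length h" for c using that by (simp add: containing_def)
    have Npos: "?N > 0" by (simp only: of_nat_0_less_iff)
    have bern: "?z ^ ?X * (1 - real ?X / ?N * w) \<le> z t ^ ?X"
      if w: "0 \<le> w" "w \<le> 1" "?z * (1 - w / ?N) \<le> z t" for w
    proof -
      have "1 \<le> ?N" by simp
      then have le1: "w / ?N \<le> 1" using w by (subst divide_le_eq_1_pos) linarith+
      have "?z ^ ?X * (1 - real ?X / ?N * w) \<le> ?z ^ ?X * (1 - w / ?N) ^ ?X"
        using Bernoulli_inequality[of "- (w / ?N)" ?X] le1 z(1)[of "Suc t"]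
        by (intro mult_left_mono) auto
      also have "\<dots> = (?z * (1 - w / ?N)) ^ ?X" by (simp add: power_mult_distrib)
      also have "\<dots> \<le> z t ^ ?X"
        using w z(1)[of "Suc t"] le1 by (intro power_mono mult_nonneg_nonneg) auto
      finally show ?thesis .
    qed
    have "avg k (?\<Phi> (Suc t)) h \<le> ?\<Phi> t h"
    proof (cases "first_hub k s e h = None")
      case False
      then have "first_hub k s e (c # h) \<noteq> None" for c by auto
      then show ?thesis using False by (simp only: avg_def of_bool_eq simp_thms mult_zero_left sum.neutral_const)
    next
      case True
      show ?thesis
      proof (cases "t < s")
        case True
        then have N: "first_hub k s e (c # h) = None" for c using t by (intro first_hub_None) auto
        have "avg k (?\<Phi> (Suc t)) h = ?z ^ ?X + real ?X / ?N * (?z ^ (?X + (k - 2)) - ?z ^ ?X)"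
        proof (rule avg_urn[OF sub])
          fix c assume "c \<le> k * length h"
          then show "?\<Phi> (Suc t) (c # h) = (if c \<in> containing k h e then ?z ^ (?X + (k - 2)) else ?z ^ ?X)"
            using N card_containing_Cons[OF notin, of c] inU assms(3) by simp
        qed
        also have "\<dots> = ?z ^ ?X * (1 - real ?X / ?N * (1 - ?z ^ (k - 2)))"
          by (simp add: power_add algebra_simps diff_divide_distrib del: of_nat_add of_nat_mult of_nat_Suc)
        also have "\<dots> \<le> z t ^ ?X"
          using z1[of t] True t z(1)[of "Suc t"] z(2)[of "Suc t"] by (intro bern) (auto intro: power_le_one less_imp_le)
        finally show ?thesis using \<open>first_hub k s e h = None\<close> by simp
      next
        case False
        have "avg k (?\<Phi> (Suc t)) h = ?z ^ ?X + real ?X / ?N * (0 - ?z ^ ?X)"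
        proof (rule avg_urn[OF sub])
          fix c assume "c \<le> k * length h"
          then show "?\<Phi> (Suc t) (c # h) = (if c \<in> containing k h e then 0 else ?z ^ ?X)"
            using False \<open>first_hub k s e h = None\<close> t card_containing_Cons[OF notin, of c] inU by simp
        qed
        also have "\<dots> = ?z ^ ?X * (1 - real ?X / ?N * 1)"
          by (simp add: algebra_simps del: of_nat_add of_nat_mult of_nat_Suc)
        also have "\<dots> \<le> z t ^ ?X"
          using z2[of t] False t by (intro bern) auto
        finally show ?thesis using \<open>first_hub k s e h = None\<close> by simp
      qed
    qed
    then show "avg k (?\<Phi> (Suc t)) h \<le> 1 / 1 * ?\<Phi> t h" by simp
  qed (use assms in auto)
  moreover have "first_hub k s e h = None" using assms by (intro first_hub_None) auto
  ultimately show ?thesis using z(3) by simp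
qed

text \<open>\<open>(t + 1) powr (b / k)\<close> meets the one-step condition for a potential that
  loses the fraction \<open>b\<close> per hit: its logarithm grows by at most
  \<open>b / (k * (t + 1))\<close>, which is at most \<open>b / (k * t + 1)\<close>.\<close>

lemma powr_ratio_ge:
  assumes "k \<ge> 1" "0 \<le> b" "b \<le> (1::real)"
  shows "((real t + 2) powr (b / k)) * (1 - b / real (k * t + 1)) \<le> (real t + 1) powr (b / k)"
proof -
  have "ln ((real t + 2) / (real t + 1)) = ln (1 + 1 / (real t + 1))"
    by (rule arg_cong[of _ _ ln]) (simp add: field_simps)
  also have "\<dots> \<le> 1 / (real t + 1)" by (rule ln_add_one_self_le_self) simp
  finally have 1: "ln (real t + 2) - ln (real t + 1) \<le> 1 / (real t + 1)"
    by (simp add: ln_div)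
  have "1 / (real t + 1) / k \<le> 1 / real (k * t + 1)"
  proof -
    have "real (k * t + 1) \<le> real (k * t + k)" using assms by (intro of_nat_mono) simp
    then have "1 / real (k * t + k) \<le> 1 / real (k * t + 1)"
      by (intro divide_left_mono) (auto simp del: of_nat_add of_nat_mult of_nat_Suc)
    then show ?thesis by (simp add: algebra_simps)
  qed
  then have 2: "(ln (real t + 2) - ln (real t + 1)) * (1 / k) \<le> 1 / real (k * t + 1)"
    using divide_right_mono[OF 1, of "real k"] by (simp del: of_nat_add of_nat_mult of_nat_Suc)
  have "1 - b / real (k * t + 1) \<le> exp (- (b / real (k * t + 1)))"
    using exp_ge_add_one_self[of "- (b / real (k * t + 1))"] by simp
  also have "\<dots> \<le> exp (- (b * ((ln (real t + 2) - ln (real t + 1)) * (1 / k))))"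
    using mult_left_mono[OF 2 assms(2)] by simp
  finally have "(real t + 2) powr (b / k) * (1 - b / real (k * t + 1)) \<le>
     exp (b / k * ln (real t + 2)) * exp (- (b * ((ln (real t + 2) - ln (real t + 1)) * (1 / k))))"
    by (simp add: powr_def mult_left_mono del: of_nat_add of_nat_mult of_nat_Suc)
  also have "\<dots> = (real t + 1) powr (b / k)"
    by (simp add: powr_def right_diff_distrib diff_divide_distrib flip: exp_add)
  finally show ?thesis .
qed

text \<open>Two regimes of \<open>z\<close> are glued at \<open>s\<close>, where
  \<open>z s = y\<close>. After \<open>s\<close> a hit is fatal, so the lost fraction is
  \<open>1\<close>. Before \<open>s\<close> it multiplies the potential by at most
  \<open>y ^ (k - 2)\<close>, so the lost fraction is at least \<open>b\<close>. The
  \<open>k - 1\<close> cliques around \<open>e\<close> at time \<open>m\<close> give the outer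
  power.\<close>

lemma avg_first_hub_None_le:
  fixes b :: real
  assumes "k \<ge> 2" "e \<subseteq> {..<k + m}" "card e = 2" "m \<le> s" "s \<le> n" "length h = m" "valid k h"
    and "k - 1 \<le> card (containing k h e)"
    and b: "0 \<le> b" "b \<le> 1 - (((real s + 1) / (real n + 1)) powr (1 / k)) ^ (k - 2)"
  shows "(avg k ^^ (n - m)) (\<lambda>h. of_bool (first_hub k s e h = None)) h
    \<le> (((real s + 1) / (real n + 1)) powr (1 / k) * ((real m + 1) / (real s + 1)) powr (b / k)) ^ (k - 1)"
proof -
  define y where "y = ((real s + 1) / (real n + 1)) powr (1 / k)"
  define z where "z t = (if t < s then y * ((real t + 1) / (real s + 1)) powr (b / k)
     else if t \<le> n then ((real t + 1) / (real n + 1)) powr (1 / k) else 1)" for t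
  have y: "0 < y" "y \<le> 1" using assms(5) by (auto simp: y_def intro!: powr_le1)
  have b1: "b \<le> 1" using b(2) zero_le_power[of y "k - 2"] y(1) unfolding y_def[symmetric] by linarith
  have zs: "z s = y" using assms(5) by (simp add: z_def y_def)
  have z_le_y: "z t \<le> y" if "t \<le> s" for t
  proof (cases "t = s")
    case False
    then have "((real t + 1) / (real s + 1)) powr (b / k) \<le> 1"
      using that b assms(1) by (intro powr_le1) auto
    then show ?thesis using that False y by (simp add: z_def mult_left_le)
  qed (simp add: zs)
  have zpos: "0 < z t" for t using y by (auto simp: z_def)
  have zle1: "z t \<le> 1" for t
    using z_le_y[of t] y by (cases "t \<le> s") (auto simp: z_def intro!: powr_le1)
  have "(avg k ^^ (n - m)) (\<lambda>h. of_bool (first_hub k s e h = None)) h \<le> z m ^ card (containing k h e)"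
  proof (rule avg_first_hub_None[OF assms(1-7) zpos zle1])
    show "z n = 1" using assms(5) by (auto simp: z_def)
  next
    fix t assume t: "m \<le> t" "t < s"
    have zt: "z t' = y * ((real t' + 1) powr (b / k) / (real s + 1) powr (b / k))" if "t' \<le> s" for t'
      using that zs by (cases "t' = s") (auto simp: z_def powr_divide)
    have "z (Suc t) ^ (k - 2) \<le> y ^ (k - 2)"
      using z_le_y[of "Suc t"] t zpos[of "Suc t"] by (intro power_mono) (auto simp: less_imp_le)
    then have "b \<le> 1 - z (Suc t) ^ (k - 2)" using b(2) by (simp add: y_def)
    then have "b / real (k * t + 1) \<le> (1 - z (Suc t) ^ (k - 2)) / real (k * t + 1)"
      by (intro divide_right_mono) auto
    then have "z (Suc t) * (1 - (1 - z (Suc t) ^ (k - 2)) / real (k * t + 1)) \<le> z (Suc t) * (1 - b / real (k * t + 1))"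
      using zpos[of "Suc t"] by (intro mult_left_mono) auto
    also have "\<dots> = y * (((real t + 2) powr (b / k) * (1 - b / real (k * t + 1))) / (real s + 1) powr (b / k))"
      using t by (subst zt) (auto simp: add.commute)
    also have "\<dots> \<le> y * ((real t + 1) powr (b / k) / (real s + 1) powr (b / k))"
      using powr_ratio_ge[of k b t] b(1) b1 y assms(1) by (intro mult_left_mono divide_right_mono) auto
    also have "\<dots> = z t" using t by (subst zt) auto
    finally show "z (Suc t) * (1 - (1 - z (Suc t) ^ (k - 2)) / real (k * t + 1)) \<le> z t" .
  next
    fix t assume t: "s \<le> t" "t < n"
    have zt: "z t' = (real t' + 1) powr (1 / k) / (real n + 1) powr (1 / k)" if "s \<le> t'" "t' \<le> n" for t'
      using that by (auto simp: z_def powr_divide)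
    have "z (Suc t) * (1 - 1 / real (k * t + 1)) = ((real t + 2) powr (1 / k) * (1 - 1 / real (k * t + 1))) / (real n + 1) powr (1 / k)"
      using t by (subst zt) (auto simp: add.commute)
    also have "\<dots> \<le> (real t + 1) powr (1 / k) / (real n + 1) powr (1 / k)"
      using powr_ratio_ge[of k 1 t] assms(1) by (intro divide_right_mono) auto
    also have "\<dots> = z t" using t by (subst zt) auto
    finally show "z (Suc t) * (1 - 1 / real (k * t + 1)) \<le> z t" .
  qed
  also have "\<dots> \<le> z m ^ (k - 1)"
    using zpos[of m] zle1[of m] assms(8) by (intro power_decreasing) auto
  also have "z m = y * ((real m + 1) / (real s + 1)) powr (b / k)"
    using zs assms(4) by (cases "m = s") (auto simp: z_def)
  finally show ?thesis by (simp add: y_def)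
qed

text \<open>While the hub does not exist yet, \<open>hub\<close> takes the value it will have at the hub's birth,
  which keeps it constant until then.\<close>
definition hub :: "nat \<Rightarrow> nat \<Rightarrow> nat \<Rightarrow> nat set \<Rightarrow> nat list \<Rightarrow> real" where
  "hub k s j e h = (case first_hub k s e h of None \<Rightarrow> rising (real (k - 1)) j (real k)
     | Some w \<Rightarrow> rising (real (k - 1)) j (real (card (containing k h {w}))))"

lemma hub_nonneg: "0 \<le> hub k s j e h"
  by (auto simp: hub_def split: option.splits intro!: rising_nonneg)

lemma rising_initial_le:
  assumes "k \<ge> 1" "j \<ge> 1" shows "rising (real (k - 1)) j (real k) \<le> real (k * j) ^ j"
proof -
  have "rising (real (k - 1)) j (real k) \<le> (\<Prod>i<j. real (k * j))"
    unfolding rising_def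
  proof (rule prod_mono)
    fix i assume i: "i \<in> {..<j}"
    have "k + i * (k - 1) \<le> k + i * k" by simp
    also have "\<dots> = k * Suc i" by simp
    also have "\<dots> \<le> k * j" using i by (intro mult_le_mono2) auto
    finally have "real (k + i * (k - 1)) \<le> real (k * j)" by (rule of_nat_mono)
    then show "0 \<le> real k + real i * real (k - 1) \<and> real k + real i * real (k - 1) \<le> real (k * j)"
      by simp
  qed
  then show ?thesis by simp
qed

text \<open>The rate uses \<open>t - 1\<close> because \<open>ln t - ln (t - 1) \<ge> 1 / t\<close>;
  thus a pure power bounds the growth of the \<open>j\<close>-th moment.\<close>

lemma powr_growth:
  assumes "k \<ge> 1" "t \<ge> 2"
  shows "1 + real j * real (k - 1) / real (k * t + 1)
    \<le> ((real t) powr (real (k - 1) / real k)) ^ j / ((real t - 1) powr (real (k - 1) / real k)) ^ j"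
proof -
  have "ln ((real t - 1) / real t) = ln (1 + (- 1 / real t))"
    using assms by (intro arg_cong[of _ _ ln]) (simp add: field_simps)
  also have "\<dots> \<le> - 1 / real t"
    using assms by (intro ln_add_one_self_le_self2) (simp add: field_simps)
  finally have 1: "1 / real t \<le> ln (real t) - ln (real t - 1)" using assms by (simp add: ln_div)
  have "real j * real (k - 1) / real (k * t + 1) \<le> real j * real (k - 1) / real (k * t)"
    using assms by (intro divide_left_mono mult_pos_pos) (auto simp del: of_nat_add of_nat_mult of_nat_Suc)
  also have "\<dots> = real j * (real (k - 1) / real k) * (1 / real t)" by simp
  also have "\<dots> \<le> real j * (real (k - 1) / real k) * (ln (real t) - ln (real t - 1))"
    using 1 by (intro mult_left_mono) auto
  finally have "1 + real j * real (k - 1) / real (k * t + 1)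
      \<le> exp (real j * (real (k - 1) / real k) * (ln (real t) - ln (real t - 1)))"
    using exp_ge_add_one_self[of "real j * (real (k - 1) / real k) * (ln (real t) - ln (real t - 1))"] by linarith
  also have "\<dots> = ((real t) powr (real (k - 1) / real k)) ^ j / ((real t - 1) powr (real (k - 1) / real k)) ^ j"
  proof -
    have "exp (real j * a * (p - q)) = exp (a * p) ^ j / exp (a * q) ^ j" for a p q :: real
      by (simp add: exp_of_nat_mult mult.assoc right_diff_distrib exp_diff power_divide)
    from this[of "real (k - 1) / real k"] show ?thesis using assms by (simp only: powr_def) simp
  qed
  finally show ?thesis .
qed

text \<open>A hub born after \<open>s\<close> is treated as if born at \<open>s\<close>:
  \<open>hub\<close> is constant until the birth, while the comparison rate \<open>g\<close> grows
  anyway. Before \<open>s\<close> no hub can appear and \<open>g\<close> is frozen.\<close>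

lemma avg_hub:
  assumes "k \<ge> 2" "e \<subseteq> {..<k + m}" "m \<le> s" "s \<le> n" "length h = m" "valid k h" "s \<ge> 2" "j \<ge> 1"
  shows "(avg k ^^ (n - m)) (hub k s j e) h \<le> (real (k * j) * ((real n - 1) / (real s - 1)) powr (real (k - 1) / real k)) ^ j"
proof -
  define g where "g t = (if t < s then ((real s - 1) powr (real (k - 1) / real k)) ^ j else ((real t - 1) powr (real (k - 1) / real k)) ^ j)" for t
  have gpos: "g t > 0" for t using assms(7) by (auto simp: g_def)
  have "(avg k ^^ (n - m)) (hub k s j e) h \<le> g n / g m * hub k s j e h"
  proof (rule avg_pow_supermartingale[where \<Phi> = "\<lambda>_. hub k s j e"])
    fix t h assume t: "m \<le> t" "t < n" "length (h::nat list) = t"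
    show "avg k (hub k s j e) h \<le> g (Suc t) / g t * hub k s j e h"
    proof (cases "t < s")
      case True
      then have "first_hub k s e (c # h) = None" "first_hub k s e h = None" for c
        using t by (intro first_hub_None, simp)+
      then have "avg k (hub k s j e) h = hub k s j e h"
        by (simp add: avg_def hub_def del: of_nat_add of_nat_Suc of_nat_mult first_hub.simps)
      moreover have "g (Suc t) = g t" using True by (cases "Suc t = s") (auto simp: g_def)
      ultimately show ?thesis using gpos[of t] by simp
    next
      case False
      have ratio: "1 + real j * real (k - 1) / real (k * t + 1) \<le> g (Suc t) / g t"
        using powr_growth[of k t j] False assms by (simp add: g_def)
      have "avg k (hub k s j e) h \<le> (1 + real j * real (k - 1) / real (k * t + 1)) * hub k s j e h"
      proof (cases "first_hub k s e h")
        case None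
        have "hub k s j e (c # h) = hub k s j e h" for c
          using card_containing_new[of "{}" k h c] None by (auto simp: hub_def)
        then have "avg k (hub k s j e) h = hub k s j e h"
          by (simp add: avg_def del: of_nat_add of_nat_Suc of_nat_mult)
        then show ?thesis using hub_nonneg[of k s j e h] by (simp add: mult_left_le algebra_simps)
      next
        case (Some w)
        have w: "w < k + length h" using first_hub_SomeD[OF Some] by auto
        have "avg k (hub k s j e) h = avg k (\<lambda>h. rising (real (k - 1)) j (real (card (containing k h {w})))) h"
          unfolding avg_def using Some by (simp add: hub_def)
        also have "\<dots> = (1 + real j * real (k - 1) / real (k * length h + 1)) * rising (real (k - 1)) j (real (card (containing k h {w})))"
        proof (rule avg_rising)
          show "card (containing k (c # h) {w}) = card (containing k h {w}) + (if c \<in> containing k h {w} then k - 1 else 0)"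
            if "c \<le> k * length h" for c
            using card_containing_Cons[of k h "{w}" c] w that by (simp add: containing_def)
        qed (auto simp: containing_def)
        also have "\<dots> = (1 + real j * real (k - 1) / real (k * t + 1)) * hub k s j e h"
          using Some t by (simp add: hub_def)
        finally show ?thesis by simp
      qed
      also have "\<dots> \<le> g (Suc t) / g t * hub k s j e h"
        by (intro mult_right_mono ratio hub_nonneg)
      finally show ?thesis .
    qed
  qed (use assms gpos in auto)
  also have "g n / g m = (((real n - 1) / (real s - 1)) powr (real (k - 1) / real k)) ^ j"
    using assms by (cases "m = s") (auto simp: g_def powr_divide power_divide)
  also have "hub k s j e h = rising (real (k - 1)) j (real k)"
    using assms by (simp add: hub_def first_hub_None)
  also have "(((real n - 1) / (real s - 1)) powr (real (k - 1) / real k)) ^ j * rising (real (k - 1)) j (real k)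
      \<le> (((real n - 1) / (real s - 1)) powr (real (k - 1) / real k)) ^ j * real (k * j) ^ j"
    using assms by (intro mult_left_mono rising_initial_le) auto
  finally show ?thesis by (simp only: power_mult_distrib mult.commute)
qed

definition fails :: "nat \<Rightarrow> nat \<Rightarrow> real \<Rightarrow> nat set \<Rightarrow> nat list \<Rightarrow> bool" where
  "fails k s lam e h \<longleftrightarrow> (case first_hub k s e h of None \<Rightarrow> True | Some w \<Rightarrow> lam < real (card (containing k h {w})))"

text \<open>Either no hub appears, or the hub lies in more than \<open>lam\<close> cliques; for the
  latter, Markov's inequality is applied to the \<open>j\<close>-th rising factorial, which
  dominates the \<open>j\<close>-th power.\<close>

lemma avg_fails:
  fixes b :: real
  assumes "k \<ge> 2" "e \<subseteq> {..<k + m}" "card e = 2" "m \<le> s" "s \<le> n" "length h = m" "valid k h"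
    and "k - 1 \<le> card (containing k h e)" "s \<ge> 2" "j \<ge> 1" "lam > 0"
    and b: "0 \<le> b" "b \<le> 1 - (((real s + 1) / (real n + 1)) powr (1 / k)) ^ (k - 2)"
  shows "(avg k ^^ (n - m)) (\<lambda>h. of_bool (fails k s lam e h)) h
    \<le> (((real s + 1) / (real n + 1)) powr (1 / k) * ((real m + 1) / (real s + 1)) powr (b / k)) ^ (k - 1)
      + (real (k * j) * ((real n - 1) / (real s - 1)) powr (real (k - 1) / real k) / lam) ^ j"
proof -
  have "(avg k ^^ (n - m)) (\<lambda>h. of_bool (fails k s lam e h)) h
      \<le> (avg k ^^ (n - m)) (\<lambda>h. of_bool (first_hub k s e h = None) + 1 / lam ^ j * hub k s j e h) h"
  proof (rule avg_pow_mono[OF _ assms(7)])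
    fix g let ?h = "g @ h"
    show "of_bool (fails k s lam e ?h) \<le> of_bool (first_hub k s e ?h = None) + 1 / lam ^ j * hub k s j e ?h"
    proof (cases "first_hub k s e ?h")
      case None
      then show ?thesis using hub_nonneg[of k s j e ?h] \<open>lam > 0\<close> by simp
    next
      case (Some w)
      have "lam ^ j \<le> hub k s j e ?h" if "lam < real (card (containing k ?h {w}))"
        using that \<open>lam > 0\<close> Some by (auto simp: hub_def intro!: rising_ge_power)
      then show ?thesis using Some hub_nonneg[of k s j e ?h] \<open>lam > 0\<close> by (auto simp: fails_def)
    qed
  qed
  also have "\<dots> = (avg k ^^ (n - m)) (\<lambda>h. of_bool (first_hub k s e h = None)) h + 1 / lam ^ j * (avg k ^^ (n - m)) (hub k s j e) h"
    by (simp only: avg_pow_add avg_pow_cmult)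
  also have "\<dots> \<le> (((real s + 1) / (real n + 1)) powr (1 / k) * ((real m + 1) / (real s + 1)) powr (b / k)) ^ (k - 1)
      + 1 / lam ^ j * (real (k * j) * ((real n - 1) / (real s - 1)) powr (real (k - 1) / real k)) ^ j"
    using assms(11) by (intro add_mono mult_left_mono avg_first_hub_None_le[OF assms(1-8) b] avg_hub[OF assms(1,2,4-7,9,10)]) auto
  finally show ?thesis by (simp add: power_divide)
qed

section \<open>Counting the bad vertices\<close>

definition good :: "nat \<Rightarrow> real \<Rightarrow> real \<Rightarrow> nat list \<Rightarrow> nat \<Rightarrow> bool" where
  "good k M Q h v \<longleftrightarrow> (\<exists>Q'\<le>Q. walk (ktree_of k h) M v 0 Q')"

lemma sum_list_two_costs:
  "(\<Sum>t\<leftarrow>xs. if m \<le> (t::nat) then (a::real) else b)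
    = real (length (filter (\<lambda>t. m \<le> t) xs)) * a + real (length (filter (\<lambda>t. t < m) xs)) * b"
  by (induction xs) (auto simp: algebra_simps)

text \<open>The hub serves as the low-degree end of both edges of the detour.\<close>

lemma walk_hub:
  assumes "k \<ge> 2" "u < length h" "\<not> fails k s lam {k + u, parent k h u} h" "0 < lam" "lam \<le> M"
  shows "walk (ktree_of k h) M (k + u) (parent k h u) (2 * lam)"
proof -
  obtain w where w: "first_hub k s {k + u, parent k h u} h = Some w" "real (card (containing k h {w})) \<le> lam"
    using assms(3) by (auto simp: fails_def split: option.splits)
  obtain t where t: "w = k + t" "t < length h" "{k + u, w} \<in> ktree_of k h" "{parent k h u, w} \<in> ktree_of k h"
    using first_hub_SomeD[OF w(1)] by auto
  have deg: "real (card (nbrs (ktree_of k h) w)) \<le> lam"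
    using card_nbrs_le_containing[OF assms(1) t(2)] w(2) t(1) by simp
  have "walk (ktree_of k h) M (k + u) w lam" "walk (ktree_of k h) M (parent k h u) w lam"
    using deg t assms by (auto intro!: walk_edge)
  from walk_trans[OF this(1) walk_sym[OF this(2)]] show ?thesis by simp
qed

text \<open>Late edges are paid with the piece bound \<open>B\<close>, early ones with a detour of
  cost \<open>2 * lam\<close>. \<open>B + lam\<close> serves as the cap on the cost of a single
  edge.\<close>

lemma good_if:
  fixes B lam :: real
  assumes k: "k \<ge> 2" and h: "length h = m" "h' = g @ h" and t: "m \<le> t" "t < length h'"
    and A: "A = piece_of k m h' (Suc (k * t))" and pos: "0 < B" "0 < lam"
    and B: "real (card (piece k m h' A)) \<le> B"
    and L2: "length (filter (\<lambda>t. m \<le> t) (chain k h' (Suc (k * t)))) \<le> L2"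
    and L1: "length (chain k h A) \<le> L1"
    and ok: "\<And>u. u \<in> set (chain k h A) \<Longrightarrow> \<not> fails k s lam {k + u, parent k h u} h'"
  shows "good k (B + lam) (real L2 * B + real L1 * (2 * lam)) h' (k + t)"
proof -
  let ?i = "Suc (k * t)" and ?\<kappa> = "\<lambda>u. if m \<le> u then B else 2 * lam"
  have k1: "k \<ge> 1" using k by simp
  have early: "filter (\<lambda>t. t < m) (chain k h' ?i) = chain k h A"
    unfolding A h(2) by (rule filter_chain[OF h(1)])
  have "walk (ktree_of k h') (B + lam) (newest k h' ?i) 0 (\<Sum>u\<leftarrow>chain k h' ?i. ?\<kappa> u)"
  proof (rule walk_chain[OF k1])
    fix u assume u: "u \<in> set (chain k h' ?i)"
    have ul: "u < length h'" using chain_less[OF u] .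
    show "walk (ktree_of k h') (B + lam) (k + u) (parent k h' u) (?\<kappa> u)"
    proof (cases "m \<le> u")
      case True
      have "card (nbrs (ktree_of k h') (k + u)) \<le> card (containing k h' {k + u})"
        by (rule card_nbrs_le_containing[OF k ul])
      also have "\<dots> \<le> card (piece k m h' (piece_of k m h' (Suc (k * u))))"
        by (intro card_mono containing_subset_piece k1 True) simp
      also have "piece_of k m h' (Suc (k * u)) = A"
        unfolding A using piece_of_chain[OF k1 u True] by simp
      finally have "real (card (nbrs (ktree_of k h') (k + u))) \<le> B" using B by linarith
      then show ?thesis using parent_edge[OF k1 ul] True pos by (auto intro!: walk_edge)
    next
      case False
      then have "u \<in> set (chain k h A)" using u early[symmetric] by simp
      then have "\<not> fails k s lam {k + u, parent k h' u} h'"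
        using ok[of u] parent_append[of u h k g] False h by simp
      then show ?thesis using False pos walk_hub[OF k ul, of s lam "B + lam"] by simp
    qed
  qed
  moreover have "newest k h' ?i = k + t" using newest_new_id[OF k1 t(2)] .
  moreover have "(\<Sum>u\<leftarrow>chain k h' ?i. ?\<kappa> u) \<le> real L2 * B + real L1 * (2 * lam)"
    unfolding sum_list_two_costs early using L1 L2 pos by (intro add_mono mult_right_mono) auto
  ultimately show ?thesis by (auto simp: good_def)
qed

text \<open>A bad vertex is created before \<open>m\<close>, lies in a piece larger than
  \<open>B\<close>, has a long late path, or lies in a piece whose early path is long or contains a
  failing edge. The last kind is counted per clique at time \<open>m\<close>, each charged at most
  \<open>B\<close>; that is why large pieces are split off.\<close>

lemma card_bad_le:
  fixes B lam :: real
  assumes k: "k \<ge> 2" and h: "length h = m" "h' = g @ h" and n: "length h' = n" and v: "valid k h'"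
    and pos: "0 < B" "0 < lam"
  shows "real (card {v. v < k + n \<and> \<not> good k (B + lam) (real L2 * B + real L1 * (2 * lam)) h' v})
    \<le> real (k + m) + (\<Sum>A\<le>k * m. (real (card (piece k m h' A)))\<^sup>2) / B + depth_weight k m h' / 2 ^ L2
      + B * depth_weight k 0 h / 2 ^ L1
      + B * (\<Sum>A | A \<le> k * m \<and> length (chain k h A) \<le> L1. \<Sum>u\<in>set (chain k h A).
          of_bool (fails k s lam {k + u, parent k h u} h'))"
    (is "real (card ?bad) \<le> _ + ?S2 + ?S3 + ?S4 + B * ?S5")
proof -
  have mn: "m \<le> n" using h n by auto
  \<comment> \<open>Sends every number issued at step \<open>t\<close> to the vertex
    \<open>k + t\<close>; number \<open>0\<close> goes to \<open>k\<close>, harmless in an upper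
    bound.\<close>
  let ?f = "\<lambda>i. k + (i - 1) div k"
  let ?N = "\<lambda>A. real (card (piece k m h' A))"
  let ?P5 = "\<lambda>A. length (chain k h A) \<le> L1 \<and> (\<exists>u\<in>set (chain k h A). fails k s lam {k + u, parent k h u} h')"
  let ?P = "\<lambda>A. ?N A \<le> B \<and> (L1 < length (chain k h A) \<or> ?P5 A)"
  define V2 where "V2 = {i. i \<le> k * n \<and> B < ?N (piece_of k m h' i)}"
  define V3 where "V3 = {i. i \<le> k * n \<and> L2 < length (filter (\<lambda>t. m \<le> t) (chain k h' i))}"
  define V4 where "V4 = {i. i \<le> k * n \<and> ?P (piece_of k m h' i)}"
  have fin: "finite V2" "finite V3" "finite V4"
    by (rule finite_subset[of _ "{..k * n}"]; auto simp: V2_def V3_def V4_def)+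
  have "?bad \<subseteq> {..<k + m} \<union> ?f ` (V2 \<union> V3 \<union> V4)"
  proof
    fix v assume v: "v \<in> ?bad"
    show "v \<in> {..<k + m} \<union> ?f ` (V2 \<union> V3 \<union> V4)"
    proof (cases "v < k + m")
      case False
      define t where "t = v - k"
      have t: "v = k + t" "m \<le> t" "t < length h'" using False v n by (auto simp: t_def)
      have "Suc (k * t) \<in> V2 \<union> V3 \<union> V4"
      proof (rule ccontr)
        assume "\<not> ?thesis"
        moreover have "Suc (k * t) \<le> k * n" using new_id_bounds[of k t h'] k t n by simp
        ultimately have "good k (B + lam) (real L2 * B + real L1 * (2 * lam)) h' (k + t)"
          by (intro good_if[OF k h t(2,3) refl pos, where s = s]) (auto simp: V2_def V3_def V4_def not_less)
        then show False using v t by simp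
      qed
      moreover have "v = ?f (Suc (k * t))" using t k by simp
      ultimately show ?thesis by blast
    qed simp
  qed
  then have "card ?bad \<le> card ({..<k + m} \<union> ?f ` (V2 \<union> V3 \<union> V4))"
    using fin by (intro card_mono) auto
  also have "\<dots> \<le> (k + m) + card (?f ` (V2 \<union> V3 \<union> V4))"
    by (rule order_trans[OF card_Un_le]) simp
  also have "card (?f ` (V2 \<union> V3 \<union> V4)) \<le> card (V2 \<union> V3 \<union> V4)"
    using fin by (intro card_image_le) auto
  also have "card (V2 \<union> V3 \<union> V4) \<le> card V2 + card V3 + card V4"
    by (rule order_trans[OF card_Un_le]) (simp add: card_Un_le)
  finally have main: "real (card ?bad) \<le> real (k + m) + (real (card V2) + real (card V3) + real (card V4))"
    by (simp flip: of_nat_add)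
  have anc_card: "real (card {i. i \<le> k * n \<and> P (piece_of k m h' i)}) = (\<Sum>A | A \<le> k * m \<and> P A. ?N A)" for P
    using card_ids_piece_of[OF v, of m P] mn n by simp
  have "real (card V2) \<le> ?S2"
  proof -
    have "real (card V2) = (\<Sum>A | A \<le> k * m \<and> B < ?N A. ?N A)"
      unfolding V2_def by (rule anc_card)
    also have "\<dots> \<le> (\<Sum>A | A \<le> k * m \<and> B < ?N A. (?N A)\<^sup>2 / B)"
      using pos by (intro sum_mono) (auto simp: power2_eq_square field_simps intro!: mult_left_mono)
    also have "\<dots> \<le> (\<Sum>A\<le>k * m. (?N A)\<^sup>2 / B)"
      using pos by (intro sum_mono2) auto
    finally show ?thesis by (simp add: sum_divide_distrib)
  qed
  moreover have "real (card V3) \<le> ?S3"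
  proof -
    have "real (card V3) * 2 ^ L2 = (\<Sum>i\<in>V3. 2 ^ L2)" by simp
    also have "\<dots> \<le> (\<Sum>i\<in>V3. 2 ^ length (filter (\<lambda>t. m \<le> t) (chain k h' i)))"
      by (intro sum_mono power_increasing) (auto simp: V3_def)
    also have "\<dots> \<le> depth_weight k m h'"
      unfolding depth_weight_def n by (intro sum_mono2) (auto simp: V3_def)
    finally show ?thesis by (simp add: field_simps)
  qed
  moreover have "real (card V4) \<le> ?S4 + B * ?S5"
  proof -
    have "real (card V4) = (\<Sum>A | A \<le> k * m \<and> ?P A. ?N A)"
      unfolding V4_def by (rule anc_card)
    also have "\<dots> \<le> (\<Sum>A | A \<le> k * m \<and> ?P A. B)" by (intro sum_mono) auto
    also have "\<dots> \<le> (\<Sum>A\<in>{A. A \<le> k * m \<and> L1 < length (chain k h A)} \<union> {A. A \<le> k * m \<and> ?P5 A}. B)"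
      using pos by (intro sum_mono2) auto
    also have "\<dots> = (\<Sum>A | A \<le> k * m \<and> L1 < length (chain k h A). B) + (\<Sum>A | A \<le> k * m \<and> ?P5 A. B)"
      by (intro sum.union_disjoint) auto
    also have "(\<Sum>A | A \<le> k * m \<and> L1 < length (chain k h A). B) \<le> ?S4"
    proof -
      have "(\<Sum>A | A \<le> k * m \<and> L1 < length (chain k h A). B) \<le> (\<Sum>A | A \<le> k * m \<and> L1 < length (chain k h A). B * (2 ^ length (chain k h A) / 2 ^ L1))"
        using pos by (intro sum_mono) (auto simp: field_simps intro!: power_increasing)
      also have "\<dots> \<le> (\<Sum>A\<le>k * m. B * (2 ^ length (chain k h A) / 2 ^ L1))"
        using pos by (intro sum_mono2) auto
      also have "\<dots> = ?S4" by (simp add: depth_weight_def h sum_distrib_left sum_divide_distrib)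
      finally show ?thesis .
    qed
    also have "(\<Sum>A | A \<le> k * m \<and> ?P5 A. B) \<le> B * ?S5"
    proof -
      let ?F = "\<lambda>A. \<Sum>u\<in>set (chain k h A). (of_bool (fails k s lam {k + u, parent k h u} h') :: real)"
      have "(\<Sum>A | A \<le> k * m \<and> ?P5 A. B) \<le> (\<Sum>A | A \<le> k * m \<and> ?P5 A. B * ?F A)"
      proof (rule sum_mono)
        fix A assume "A \<in> {A. A \<le> k * m \<and> ?P5 A}"
        then obtain u where u: "u \<in> set (chain k h A)" "fails k s lam {k + u, parent k h u} h'" by auto
        have "1 \<le> ?F A"
          using u member_le_sum[of u "set (chain k h A)" "\<lambda>u. (of_bool (fails k s lam {k + u, parent k h u} h') :: real)"]
          by simp
        then show "B \<le> B * ?F A" using pos by simp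
      qed
      also have "\<dots> \<le> (\<Sum>A | A \<le> k * m \<and> length (chain k h A) \<le> L1. B * ?F A)"
        using pos by (intro sum_mono2) (auto intro!: mult_nonneg_nonneg sum_nonneg)
      finally show ?thesis by (simp add: sum_distrib_left)
    qed
    finally show ?thesis by simp
  qed
  ultimately show ?thesis using main by linarith
qed

text \<open>Conditioning on time \<open>m\<close> fixes the early paths, so \<open>p\<close> can be
  summed over at most \<open>L1\<close> edges for each of \<open>k * m + 1\<close> cliques. The
  first \<open>m\<close> steps are averaged afterwards, and only in the early path lengths.\<close>

lemma expected_bad_le:
  fixes B lam p :: real
  assumes k: "k \<ge> 2" and m: "1 \<le> m" "m \<le> n" and pos: "0 < B" "0 < lam"
    and p: "\<And>h u. length h = m \<Longrightarrow> valid k h \<Longrightarrow> u < m \<Longrightarrow>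
      (avg k ^^ (n - m)) (\<lambda>h'. of_bool (fails k s lam {k + u, parent k h u} h')) h \<le> p"
    and p0: "0 \<le> p"
  shows "(avg k ^^ n) (\<lambda>h. real (card {v. v < k + n \<and> \<not> good k (B + lam) (real L2 * B + real L1 * (2 * lam)) h v})) []
    \<le> real (k + m) + real (k * m + 1) * (real (Suc k) * (real n / real m)\<^sup>2) / B
      + real (k * m + 1) * (real n / real m)\<^sup>2 / 2 ^ L2
      + B * ((1 + 2 * real k) * (real m)\<^sup>2) / 2 ^ L1
      + B * (real (k * m + 1) * (real L1 * p))"
    (is "(avg k ^^ n) ?bad [] \<le> _ + ?c2 + ?c3 + _ + ?c5")
proof -
  let ?fl = "\<lambda>h u h'. (of_bool (fails k s lam {k + u, parent k h u} h') :: real)"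
  have inner: "(avg k ^^ (n - m)) ?bad h \<le> real (k + m) + ?c2 + ?c3 + ?c5 + B / 2 ^ L1 * depth_weight k 0 h"
    if h: "length h = m" "valid k h" for h
  proof -
    let ?I = "{A. A \<le> k * m \<and> length (chain k h A) \<le> L1}"
    have "(avg k ^^ (n - m)) ?bad h \<le> (avg k ^^ (n - m)) (\<lambda>h'.
       (real (k + m) + 1 / B * (\<Sum>A\<le>k * m. (real (card (piece k m h' A)))\<^sup>2) + 1 / 2 ^ L2 * depth_weight k m h' + B * depth_weight k 0 h / 2 ^ L1)
        + B * (\<Sum>A\<in>?I. \<Sum>u\<in>set (chain k h A). ?fl h u h')) h"
    proof (rule avg_pow_mono[OF _ h(2)])
      fix g assume g: "length g = n - m" "valid k (g @ h)"
      show "?bad (g @ h) \<le> (real (k + m) + 1 / B * (\<Sum>A\<le>k * m. (real (card (piece k m (g @ h) A)))\<^sup>2) + 1 / 2 ^ L2 * depth_weight k m (g @ h) + B * depth_weight k 0 h / 2 ^ L1)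
        + B * (\<Sum>A\<in>?I. \<Sum>u\<in>set (chain k h A). ?fl h u (g @ h))"
        using card_bad_le[OF k h(1) refl _ g(2) pos, of n L2 L1 s] g h m by simp
    qed
    also have "\<dots> = real (k + m) + 1 / B * (\<Sum>A\<le>k * m. (avg k ^^ (n - m)) (\<lambda>h'. (real (card (piece k m h' A)))\<^sup>2) h)
        + 1 / 2 ^ L2 * (avg k ^^ (n - m)) (depth_weight k m) h + B * depth_weight k 0 h / 2 ^ L1
        + B * (\<Sum>A\<in>?I. \<Sum>u\<in>set (chain k h A). (avg k ^^ (n - m)) (?fl h u) h)"
      by (simp only: avg_pow_add avg_pow_cmult avg_pow_sum avg_pow_const)
    also have "\<dots> \<le> real (k + m) + 1 / B * (\<Sum>A\<le>k * m. real (Suc k) * (real n / real m)\<^sup>2)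
        + 1 / 2 ^ L2 * (real (k * m + 1) * (real n / real m)\<^sup>2) + B * depth_weight k 0 h / 2 ^ L1
        + B * (\<Sum>A\<le>k * m. real L1 * p)"
    proof (intro add_mono order_refl mult_left_mono sum_mono)
      show "(\<Sum>A\<in>?I. \<Sum>u\<in>set (chain k h A). (avg k ^^ (n - m)) (?fl h u) h) \<le> (\<Sum>A\<le>k * m. real L1 * p)"
      proof -
        have "(\<Sum>A\<in>?I. \<Sum>u\<in>set (chain k h A). (avg k ^^ (n - m)) (?fl h u) h) \<le> (\<Sum>A\<in>?I. real L1 * p)"
        proof (rule sum_mono)
          fix A assume A: "A \<in> ?I"
          have "(\<Sum>u\<in>set (chain k h A). (avg k ^^ (n - m)) (?fl h u) h) \<le> (\<Sum>u\<in>set (chain k h A). p)"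
            using h chain_less[of _ k h A] by (intro sum_mono p) auto
          also have "\<dots> = real (card (set (chain k h A))) * p" by simp
          also have "\<dots> \<le> real L1 * p"
            using A card_length[of "chain k h A"] p0 by (intro mult_right_mono) auto
          finally show "(\<Sum>u\<in>set (chain k h A). (avg k ^^ (n - m)) (?fl h u) h) \<le> real L1 * p" .
        qed
        also have "\<dots> \<le> (\<Sum>A\<le>k * m. real L1 * p)" using p0 by (intro sum_mono2) auto
        finally show ?thesis .
      qed
    next
      show "(avg k ^^ (n - m)) (\<lambda>h'. (real (card (piece k m h' A)))\<^sup>2) h \<le> real (Suc k) * (real n / real m)\<^sup>2"
        if "A \<in> {..k * m}" for A
        using that k m h by (intro avg_piece_sq) auto
      show "(avg k ^^ (n - m)) (depth_weight k m) h \<le> real (k * m + 1) * (real n / real m)\<^sup>2"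
        using k m h by (intro avg_pow_depth_weight) auto
    qed (use pos in auto)
    also have "\<dots> = real (k + m) + ?c2 + ?c3 + ?c5 + B / 2 ^ L1 * depth_weight k 0 h"
      by (simp add: algebra_simps add_divide_distrib)
    finally show ?thesis .
  qed
  have "(avg k ^^ n) ?bad [] = (avg k ^^ m) ((avg k ^^ (n - m)) ?bad) []"
    using m funpow_add[of m "n - m" "avg k"] by simp
  also have "\<dots> \<le> (avg k ^^ m) (\<lambda>h. (real (k + m) + ?c2 + ?c3 + ?c5) + B / 2 ^ L1 * depth_weight k 0 h) []"
    by (intro avg_pow_mono inner) auto
  also have "\<dots> = (real (k + m) + ?c2 + ?c3 + ?c5) + B / 2 ^ L1 * (avg k ^^ m) (depth_weight k 0) []"
    by (simp only: avg_pow_add avg_pow_cmult avg_pow_const)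
  also have "\<dots> \<le> (real (k + m) + ?c2 + ?c3 + ?c5) + B / 2 ^ L1 * ((1 + 2 * real k) * (real m)\<^sup>2)"
    using avg_pow_depth_weight0[of k m] k m pos by (intro add_left_mono mult_left_mono) auto
  finally show ?thesis by simp
qed

section \<open>From good vertices to the spread of the rumor\<close>

lemma expectation_uninformed_le:
  fixes P :: "nat set pmf"
  assumes "\<And>y. y \<in> Y \<Longrightarrow> measure_pmf.prob P {I. y \<notin> I} \<le> d" "Y \<subseteq> {..<N}" "0 \<le> d"
  shows "measure_pmf.expectation P (\<lambda>I. real (card ({..<N} - I))) \<le> real N * d + real (card ({..<N} - Y))"
proof -
  have "measure_pmf.expectation P (\<lambda>I. real (card ({..<N} - I)))
      = measure_pmf.expectation P (\<lambda>I. \<Sum>y<N. indicator {I. y \<notin> I} I)"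
  proof (rule arg_cong[where f = "measure_pmf.expectation P"], rule ext)
    fix I :: "nat set"
    have "(\<Sum>y<N. indicator {I. y \<notin> I} I :: real) = (\<Sum>y\<in>{..<N} - I. 1)"
      by (rule sum.mono_neutral_cong_right) (auto simp: indicator_def)
    then show "real (card ({..<N} - I)) = (\<Sum>y<N. indicator {I. y \<notin> I} I)" by simp
  qed
  also have "\<dots> = (\<Sum>y<N. measure_pmf.prob P {I. y \<notin> I})"
    by (subst Bochner_Integration.integral_sum)
       (auto intro!: measure_pmf.integrable_const_bound[where B = 1])
  also have "\<dots> \<le> (\<Sum>y<N. d + of_bool (y \<notin> Y))"
  proof (rule sum_mono)
    fix y show "measure_pmf.prob P {I. y \<notin> I} \<le> d + of_bool (y \<notin> Y)"
    proof (cases "y \<in> Y")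
      case False
      then have "of_bool (y \<notin> Y) = (1::real)" by simp
      then show ?thesis using measure_pmf.prob_le_1[of P "{I. y \<notin> I}"] assms(3) by linarith
    qed (use assms(1) in auto)
  qed
  also have "\<dots> = real N * d + (\<Sum>y<N. of_bool (y \<notin> Y))"
    by (simp add: sum.distrib)
  also have "(\<Sum>y<N. of_bool (y \<notin> Y) :: real) = (\<Sum>y\<in>{..<N} - Y. 1)"
    by (rule sum.mono_neutral_cong_right) auto
  finally show ?thesis by simp
qed

text \<open>A good source reaches each good vertex by a walk through \<open>0\<close> of cost at
  most \<open>2 * Q\<close>; Markov's inequality for the number of uninformed vertices does the
  rest. A bad source is given up.\<close>

lemma prob_few_informed_le:
  assumes k: "k \<ge> 2" and M: "M > 0" and h: "length h = n" and gg: "gg > 0" and v: "v < n + k"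
  shows "measure_pmf.prob (push_pull (ktree_of k h) (n + k) {v} T) {I. real (card I) < real n - gg}
    \<le> (real (card {v. v < k + n \<and> \<not> good k M Q h v}) + real (n + k) * exp ((4 * Q - real T) / (2 * M))) / gg
      + of_bool (\<not> good k M Q h v)"
proof (cases "good k M Q h v")
  case False
  have "0 \<le> (real (card {v. v < k + n \<and> \<not> good k M Q h v}) + real (n + k) * exp ((4 * Q - real T) / (2 * M))) / gg"
    using gg by (intro divide_nonneg_pos add_nonneg_nonneg) auto
  then show ?thesis using False measure_pmf.prob_le_1 by (smt (verit) of_bool_eq(2))
next
  case True
  let ?P = "push_pull (ktree_of k h) (n + k) {v} T" and ?N = "n + k"
  let ?Y = "{v. v < k + n \<and> good k M Q h v}"
  have "measure_pmf.prob ?P {I. y \<notin> I} \<le> exp ((4 * Q - real T) / (2 * M))" if y: "y \<in> ?Y" for y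
  proof -
    obtain Q1 Q2 where Q: "Q1 \<le> Q" "Q2 \<le> Q" "walk (ktree_of k h) M v 0 Q1" "walk (ktree_of k h) M y 0 Q2"
      using True y by (auto simp: good_def)
    have "measure_pmf.prob ?P {I. y \<notin> I} \<le> exp ((2 * (Q1 + Q2) - real T) / (2 * M))"
      by (rule push_pull_walk[OF walk_trans[OF Q(3) walk_sym[OF Q(4)]] M])
         (use h ktree_edge_less[of _ _ k h] in \<open>auto simp: add.commute\<close>)
    also have "\<dots> \<le> exp ((4 * Q - real T) / (2 * M))"
      using Q M by (intro iffD2[OF exp_le_cancel_iff] divide_right_mono) auto
    finally show ?thesis .
  qed
  then have E: "measure_pmf.expectation ?P (\<lambda>I. real (card ({..<?N} - I)))
      \<le> real ?N * exp ((4 * Q - real T) / (2 * M)) + real (card ({..<?N} - ?Y))"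
    by (intro expectation_uninformed_le) auto
  have eq: "{..<?N} - ?Y = {v. v < k + n \<and> \<not> good k M Q h v}" by auto
  have int: "integrable (measure_pmf ?P) (\<lambda>I. real (card ({..<?N} - I)))"
    by (rule measure_pmf.integrable_const_bound[where B = "real ?N"])
       (auto intro!: AE_I2 card_mono[of "{..<n + k}", simplified] simp flip: of_nat_add)
  have "measure_pmf.prob ?P {I. real (card I) < real n - gg} \<le> measure_pmf.prob ?P {I. gg \<le> real (card ({..<?N} - I))}"
  proof -
    have "{I. real (card I) < real n - gg} \<inter> set_pmf ?P \<subseteq> {I. gg \<le> real (card ({..<?N} - I))}"
    proof
      fix I assume I: "I \<in> {I. real (card I) < real n - gg} \<inter> set_pmf ?P"
      then have "finite I" using push_pull_finite[of "{v}"] by auto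
      then have "card {..<?N} \<le> card ({..<?N} - I) + card I"
        by (metis card_Un_le card_mono finite_Un finite_Diff finite_lessThan Un_Diff_cancel2 Un_upper1 order_trans)
      then have "real n \<le> real (card ({..<?N} - I)) + real (card I)" by simp
      then show "I \<in> {I. gg \<le> real (card ({..<?N} - I))}" using I by simp
    qed
    then show ?thesis
      by (subst measure_Int_set_pmf[symmetric]) (intro measure_pmf.finite_measure_mono, auto)
  qed
  also have "\<dots> \<le> measure_pmf.expectation ?P (\<lambda>I. real (card ({..<?N} - I))) / gg"
    using integral_Markov_inequality_measure[OF int, of "{}" gg] gg by simp
  also have "\<dots> \<le> (real (card {v. v < k + n \<and> \<not> good k M Q h v}) + real ?N * exp ((4 * Q - real T) / (2 * M))) / gg"
    using E gg unfolding eq by (intro divide_right_mono) auto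
  finally show ?thesis using True by simp
qed

text \<open>The factor \<open>2\<close> covers bad targets and bad sources: a uniform source is bad
  with probability \<open>bad / (n + k)\<close>, at most \<open>bad / gg\<close>.\<close>

lemma prob_rumor_spread_ge:
  fixes gg :: real
  assumes k: "k \<ge> 2" and M: "M > 0" and gg: "gg > 0" "gg \<le> real (n + k)"
    and bad: "(avg k ^^ n) (\<lambda>h. real (card {v. v < k + n \<and> \<not> good k M Q h v})) [] \<le> b"
  shows "1 - (2 * b + real (n + k) * exp ((4 * Q - real T) / (2 * M))) / gg
    \<le> measure_pmf.prob (rumor_spread k n T) {I. real n - gg \<le> real (card I)}"
proof -
  let ?bad = "\<lambda>h. real (card {v. v < k + n \<and> \<not> good k M Q h v})"
  let ?d = "real (n + k) * exp ((4 * Q - real T) / (2 * M))"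
  let ?X = "{I :: nat set. real (card I) < real n - gg}"
  let ?V = "pmf_of_set {..<n + k}"
  have ne: "{..<n + k} \<noteq> {}" using k by (simp add: lessThan_empty_iff)
  have inner: "measure_pmf.prob (bind_pmf ?V (\<lambda>v. push_pull (ktree_of k h) (n + k) {v} T)) ?X \<le> (2 * ?bad h + ?d) / gg"
    if h: "h \<in> set_pmf (history k n)" for h
  proof -
    have len: "length h = n" using length_history[OF h] .
    have "measure_pmf.prob (bind_pmf ?V (\<lambda>v. push_pull (ktree_of k h) (n + k) {v} T)) ?X
      = (\<Sum>v<n + k. measure_pmf.prob (push_pull (ktree_of k h) (n + k) {v} T) ?X) / real (n + k)"
      using ne by (simp add: prob_bind_pmf integral_pmf_of_set)
    also have "\<dots> \<le> (\<Sum>v<n + k. (?bad h + ?d) / gg + of_bool (\<not> good k M Q h v)) / real (n + k)"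
      by (intro divide_right_mono sum_mono prob_few_informed_le[OF k M len gg(1)]) auto
    also have "\<dots> = (?bad h + ?d) / gg + (\<Sum>v<n + k. of_bool (\<not> good k M Q h v)) / real (n + k)"
      using k by (simp add: sum.distrib add_divide_distrib del: of_nat_add)
    also have "(\<Sum>v<n + k. of_bool (\<not> good k M Q h v) :: real) = (\<Sum>v | v < k + n \<and> \<not> good k M Q h v. 1)"
      by (rule sum.mono_neutral_cong_right) (auto simp: add.commute)
    also have "\<dots> / real (n + k) \<le> ?bad h / gg"
      using gg k by (auto intro!: divide_left_mono)
    finally show ?thesis by (simp add: add_divide_distrib)
  qed
  have "measure_pmf.prob (rumor_spread k n T) ?X
      = measure_pmf.expectation (history k n) (\<lambda>h. measure_pmf.prob (bind_pmf ?V (\<lambda>v. push_pull (ktree_of k h) (n + k) {v} T)) ?X)"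
    using k unfolding rumor_spread_def by (simp add: random_ktree_history bind_map_pmf prob_bind_pmf[of "history k n"])
  also have "\<dots> \<le> measure_pmf.expectation (history k n) (\<lambda>h. (2 * ?bad h + ?d) / gg)"
    by (intro integral_mono_AE AE_pmfI inner integrable_measure_pmf_finite finite_set_history)
  also have "\<dots> = (avg k ^^ n) (\<lambda>h. 2 / gg * ?bad h + ?d / gg) []"
    unfolding expectation_history by (simp add: add_divide_distrib)
  also have "\<dots> = 2 / gg * (avg k ^^ n) ?bad [] + ?d / gg"
    by (simp only: avg_pow_add avg_pow_cmult avg_pow_const)
  also have "\<dots> \<le> 2 / gg * b + ?d / gg"
    using bad gg by (intro add_right_mono mult_left_mono) auto
  finally have "measure_pmf.prob (rumor_spread k n T) ?X \<le> (2 * b + ?d) / gg"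
    by (simp add: add_divide_distrib)
  moreover have compl: "{I. real n - gg \<le> real (card I)} = UNIV - ?X" by auto
  have "measure_pmf.prob (rumor_spread k n T) {I. real n - gg \<le> real (card I)} = 1 - measure_pmf.prob (rumor_spread k n T) ?X"
    unfolding compl using measure_pmf.prob_compl[of ?X "rumor_spread k n T"] by simp
  ultimately show ?thesis by linarith
qed

section \<open>Choice of the scales\<close>

text \<open>\<open>n / m\<close> is about \<open>S\<close> and \<open>n / s\<close> about \<open>R\<close>. The exponent of \<open>R\<close> makes the degree
  \<open>R powr ((k - 1) / k)\<close> of a hub about \<open>l powr (2 / k)\<close>; the exponent of \<open>S\<close> is the largest for which
  late steps, whose degrees are bounded by the piece size, are affordable. The parameter \<open>\<eta>\<close> is the
  slack in the exponent of \<open>l\<close> that is available for \<open>k \<ge> 3\<close>.\<close>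
locale scales =
  fixes k n :: nat and l L F \<eta> :: real
  assumes k: "k \<ge> 2" and l_def: "l = ln (real n)" and L_def: "L = ln l"
    and \<eta>_def: "\<eta> = real (k - 2) / (2 * (real k)\<^sup>2)"
    and L1: "1 \<le> L" and F2: "2 \<le> F" and F5: "F ^ 5 \<le> L\<^sup>2" and Ll: "L\<^sup>2 \<le> l" and ln4: "3 * l ^ 4 \<le> real n"
    and beta: "k \<ge> 3 \<Longrightarrow> (2 / F) powr (real (k - 2) / real k) * (1 + 2 * \<eta>) \<le> \<eta>"
    and L\<eta>: "k \<ge> 3 \<Longrightarrow> L\<^sup>2 \<le> l powr \<eta>"
begin

definition "R = l powr (2 / real (k - 1)) * F ^ 4"
definition "S = l powr (1 + 2 / real k) * F ^ 4"
text \<open>The mean size of a piece is of order \<open>S\<close>; the extra \<open>F\<close> leaves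
  only O(n / F) cliques in pieces above \<open>B\<close>.\<close>

definition "B = S * F"
definition "m = nat \<lfloor>real n / S\<rfloor>"
definition "s = nat \<lfloor>real n / R\<rfloor>"
definition "j = nat \<lceil>6 * L\<rceil>"
text \<open>Since \<open>2 ^ 5\<close> exceeds \<open>exp 3\<close>, the lengths
  \<open>5 * l\<close> and \<open>5 * L\<close> make the powers of two at least \<open>n ^ 3\<close>
  and \<open>l ^ 3\<close>.\<close>

definition "d1 = nat \<lceil>5 * l\<rceil>"
definition "d2 = nat \<lceil>5 * L\<rceil>"
text \<open>\<open>k * j\<close> bounds the \<open>j\<close>-th root of the initial moment, and the
  power of \<open>3 * R\<close> the growth of the urn. The factor \<open>exp 1\<close> makes the
  ratio in Markov's inequality at most \<open>exp (- 1)\<close>, so the order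
  \<open>j \<ge> 6 * L\<close> yields \<open>1 / l ^ 6\<close>.\<close>

definition "lam = exp 1 * real k * real j * (3 * R) powr (real (k - 1) / real k)"

lemma l_ge: "1 \<le> l"
  using L1 Ll one_le_power[of L 2] by linarith

lemma L_le_l: "L \<le> l"
  using L1 Ll self_le_power[of L 2] by linarith

lemma n_pos: "0 < real n"
  using ln4 l_ge one_le_power[of l 4] by linarith

lemma n_ge1: "1 \<le> real n"
  using ln4 l_ge one_le_power[of l 4] by linarith

lemma exp_l: "exp l = real n" using n_pos by (simp add: l_def)

lemma exp_L: "exp L = l" using l_ge by (simp add: L_def)

lemma F_pow_le: "F ^ i \<le> L\<^sup>2" if "i \<le> 5"
  using power_increasing[OF that, of F] F2 F5 by linarith

lemma R_ge: "F \<le> R" "16 \<le> R"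
proof -
  have 1: "1 \<le> l powr (2 / real (k - 1))" using l_ge by (intro ge_one_powr_ge_zero) auto
  have "F ^ 4 \<le> R" unfolding R_def using mult_right_mono[OF 1, of "F ^ 4"] F2 by simp
  moreover have "F \<le> F ^ 4" using F2 by (intro self_le_power) auto
  moreover have "2 ^ 4 \<le> F ^ 4" using F2 by (intro power_mono) auto
  ultimately show "F \<le> R" "16 \<le> R" by auto
qed

lemma exponents_le: "2 / real (k - 1) \<le> 1 + 2 / real k" "1 + 2 / real k \<le> 2"
proof -
  show "1 + 2 / real k \<le> 2" using k by simp
  obtain q where q: "k = q + 2" using k by (metis add.commute le_Suc_ex)
  show "2 / real (k - 1) \<le> 1 + 2 / real k"
    unfolding q by (simp add: field_simps)
qed

lemma frac_le_1: "real (k - 1) / real k \<le> 1"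
  using k by (subst divide_le_eq_1_pos) auto

lemma R_le_S: "R \<le> S"
  unfolding R_def S_def using l_ge F2 exponents_le(1) by (intro mult_right_mono powr_mono) auto

lemma B_le: "B \<le> l ^ 3"
proof -
  have "l powr (1 + 2 / real k) \<le> l powr 2" using l_ge exponents_le by (intro powr_mono) auto
  also have "\<dots> = l ^ 2" using l_ge by (simp add: powr_numeral)
  finally have "l powr (1 + 2 / real k) * F ^ 5 \<le> l ^ 2 * l"
    using F_pow_le[of 5] Ll F2 l_ge by (intro mult_mono) auto
  moreover have "B = l powr (1 + 2 / real k) * F ^ 5"
    by (simp add: B_def S_def eval_nat_numeral)
  ultimately show ?thesis by (simp add: eval_nat_numeral)
qed

lemma S_pos: "0 < S" using R_le_S R_ge by linarith

lemma F_le_S: "F \<le> S" using R_le_S R_ge by linarith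

lemma B_pos: "0 < B" using S_pos F2 by (simp add: B_def)

lemma S_le_n: "3 * S \<le> real n"
proof -
  have "3 * S \<le> 3 * B" using S_pos F2 by (simp add: B_def)
  also have "\<dots> \<le> 3 * l ^ 4" using B_le l_ge power_increasing[of 3 4 l] by simp
  finally show ?thesis using ln4 by simp
qed

lemma m_bounds: "real m \<le> real n / S" "real n / (2 * S) \<le> real m" "1 \<le> m" "m \<le> n"
proof -
  have "3 \<le> real n / S" using S_le_n S_pos by (simp add: field_simps)
  moreover have "real n / (2 * S) = real n / S / 2" by simp
  moreover have "real m = of_int \<lfloor>real n / S\<rfloor>" using calculation(1) by (simp add: m_def)
  ultimately show 1: "real m \<le> real n / S" "real n / (2 * S) \<le> real m" "1 \<le> m" by linarith+
  have "real n / S \<le> real n / 1" using R_le_S R_ge n_pos by (intro divide_left_mono) auto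
  then show "m \<le> n" using 1 by simp
qed

lemma s_bounds: "real s \<le> real n / R" "real n / R \<le> real s + 1" "3 \<le> real n / R" "2 \<le> s" "s \<le> n" "m \<le> s"
proof -
  show 0: "3 \<le> real n / R" using S_le_n R_le_S R_ge by (simp add: field_simps)
  have s: "real s = of_int \<lfloor>real n / R\<rfloor>" using 0 by (simp add: s_def)
  then show 1: "real s \<le> real n / R" "real n / R \<le> real s + 1" by linarith+
  show "2 \<le> s" using 0 s by linarith
  have "real n / R \<le> real n / 1" using R_ge n_pos by (intro divide_left_mono) auto
  then show "s \<le> n" using 1 by simp
  have "real n / S \<le> real n / R" using R_le_S R_ge n_pos by (intro divide_left_mono mult_pos_pos) auto
  then show "m \<le> s" unfolding m_def s_def by (intro nat_mono floor_mono)
qed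

definition "y = ((real s + 1) / (real n + 1)) powr (1 / real k)"

lemma ratio_s: "(real s + 1) / (real n + 1) \<le> 2 / R"
proof -
  have "real s + 1 \<le> real n / R + real n / R" using s_bounds by linarith
  then have "(real s + 1) / (real n + 1) \<le> (2 * (real n / R)) / (real n + 1)" by (intro divide_right_mono) auto
  also have "\<dots> \<le> (2 * (real n / R)) / real n" using n_pos R_ge by (intro divide_left_mono) auto
  also have "\<dots> = 2 / R" using n_pos by simp
  finally show ?thesis .
qed

lemma ratio_ms: "(real m + 1) / (real s + 1) \<le> 2 * R / S"
proof -
  have "1 \<le> real n / S" using S_le_n S_pos by (simp add: field_simps)
  then have "real m + 1 \<le> 2 * (real n / S)" using m_bounds(1) by linarith
  then have "(real m + 1) / (real s + 1) \<le> (2 * (real n / S)) / (real n / R)"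
    using s_bounds(2,3) S_pos by (intro frac_le) auto
  also have "\<dots> = 2 * R / S" using n_pos R_ge by (simp add: field_simps)
  finally show ?thesis .
qed

lemma y_bounds: "0 < y" "y \<le> 1" "y \<le> (2 / R) powr (1 / real k)"
  using s_bounds(5) ratio_s by (auto simp: y_def intro!: powr_le1 powr_mono2)

text \<open>The largest value allowed by \<open>avg_first_hub_None_le\<close>: it is
  \<open>0\<close> for \<open>k = 2\<close> and close to \<open>1\<close> for
  \<open>k \<ge> 3\<close> and large \<open>R\<close>.\<close>

definition "b = 1 - y ^ (k - 2)"

lemma b_bounds: "0 \<le> b" "b \<le> 1"
  using y_bounds power_le_one[of y "k - 2"] by (auto simp: b_def)

text \<open>For \<open>k = 2\<close> the bound is of order \<open>R powr (-1/2)\<close>, which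
  dictates the exponent of \<open>R\<close>. For \<open>k \<ge> 3\<close> it is nearly
  \<open>S powr (-(k-1)/k)\<close>, and (1 + 2/k)(k-1)/k = 1 + 2\<eta>: one half of the slack pays
  for \<open>b < 1\<close>, the other for \<open>F\<^sup>2\<close>.\<close>

lemma miss_prob_le: "(y * ((real m + 1) / (real s + 1)) powr (b / real k)) ^ (k - 1) \<le> 4 / (l * F\<^sup>2)"
proof (cases "k = 2")
  case True
  have "y ^ (k - 2) = 1" using True by (simp only: diff_self_eq_0 power_0)
  then have "b = 0" by (simp add: b_def)
  then have "(y * ((real m + 1) / (real s + 1)) powr (b / real k)) ^ (k - 1) = y" using True by simp
  also have "\<dots> \<le> (2 / R) powr (1 / 2)" using y_bounds True by simp
  also have "\<dots> = sqrt (2 / R)" using R_ge by (simp add: powr_half_sqrt)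
  also have "R = (l * F\<^sup>2)\<^sup>2"
    unfolding R_def using True l_ge by (simp add: powr_numeral power_mult_distrib flip: power_mult)
  also have "sqrt (2 / (l * F\<^sup>2)\<^sup>2) = sqrt 2 / (l * F\<^sup>2)"
    using l_ge by (simp add: real_sqrt_divide)
  also have "\<dots> \<le> 4 / (l * F\<^sup>2)"
    using l_ge by (intro divide_right_mono real_le_lsqrt) auto
  finally show ?thesis .
next
  case False
  then have k3: "k \<ge> 3" using k by simp
  have SR: "2 / R \<le> 1" using R_ge by simp
  \<comment> \<open>Weakening the exponent from \<open>1 / k\<close> to \<open>b / k\<close> lets
    \<open>R\<close> cancel in the product, leaving \<open>4 / S\<close>.\<close>
  have "y \<le> (2 / R) powr (b / real k)"
  proof -
    have "(2 / R) powr (1 / real k) \<le> (2 / R) powr (b / real k)"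
      using SR R_ge b_bounds by (intro powr_mono') (auto intro!: divide_right_mono)
    then show ?thesis using y_bounds by linarith
  qed
  moreover have "((real m + 1) / (real s + 1)) powr (b / real k) \<le> (2 * R / S) powr (b / real k)"
    using ratio_ms b_bounds by (intro powr_mono2) auto
  ultimately have "y * ((real m + 1) / (real s + 1)) powr (b / real k) \<le> (2 / R) powr (b / real k) * (2 * R / S) powr (b / real k)"
    using y_bounds by (intro mult_mono) auto
  also have "\<dots> = (2 / R * (2 * R / S)) powr (b / real k)"
    by (rule powr_mult[symmetric])
  also have "2 / R * (2 * R / S) = 4 / S" using R_ge by simp
  finally have "(y * ((real m + 1) / (real s + 1)) powr (b / real k)) ^ (k - 1) \<le> ((4 / S) powr (b / real k)) ^ (k - 1)"
    using y_bounds by (intro power_mono mult_nonneg_nonneg) auto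
  also have "\<dots> = (4 / S) powr (b * (real (k - 1) / real k))"
    using S_pos by (simp add: powr_powr mult.commute flip: powr_realpow)
  also have "\<dots> \<le> (4 / l powr (1 + 2 / real k)) powr (b * (real (k - 1) / real k))"
  proof (rule powr_mono2)
    have "l powr (1 + 2 / real k) * 1 \<le> S" unfolding S_def using F2 by (intro mult_left_mono one_le_power) auto
    then show "4 / S \<le> 4 / l powr (1 + 2 / real k)" using l_ge S_pos by (intro divide_left_mono) auto
  qed (use b_bounds S_pos in auto)
  also have "\<dots> = 4 powr (b * (real (k - 1) / real k)) / l powr ((1 + 2 / real k) * (b * (real (k - 1) / real k)))"
    by (simp add: powr_divide powr_powr)
  also have "\<dots> \<le> 4 / l powr (1 + \<eta>)"
  proof (rule frac_le)
    have "b * (real (k - 1) / real k) \<le> 1 * 1" using b_bounds frac_le_1 by (intro mult_mono) auto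
    then show "4 powr (b * (real (k - 1) / real k)) \<le> 4"
      using powr_mono[of "b * (real (k - 1) / real k)" 1 "4::real"] by simp
    have e: "(1 + 2 / real k) * (real (k - 1) / real k) = 1 + 2 * \<eta>"
      using k by (simp add: \<eta>_def of_nat_diff power2_eq_square field_simps)
    have \<eta>0: "0 \<le> \<eta>" by (simp add: \<eta>_def)
    have "y ^ (k - 2) \<le> ((2 / R) powr (1 / real k)) ^ (k - 2)" using y_bounds by (intro power_mono) auto
    also have "\<dots> = (2 / R) powr (real (k - 2) / real k)"
      using R_ge by (simp add: powr_powr flip: powr_realpow)
    also have "\<dots> \<le> (2 / F) powr (real (k - 2) / real k)"
      using R_ge F2 by (intro powr_mono2 divide_left_mono) auto
    finally have "y ^ (k - 2) * (1 + 2 * \<eta>) \<le> (2 / F) powr (real (k - 2) / real k) * (1 + 2 * \<eta>)"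
      using \<eta>0 by (intro mult_right_mono) auto
    then have "y ^ (k - 2) * (1 + 2 * \<eta>) \<le> \<eta>" using beta[OF k3] by linarith
    then have "1 + \<eta> \<le> (1 + 2 * \<eta>) * b" by (simp add: b_def algebra_simps)
    also have "\<dots> = (1 + 2 / real k) * (b * (real (k - 1) / real k))"
      unfolding e[symmetric] by (simp only: ac_simps)
    finally show "l powr (1 + \<eta>) \<le> l powr ((1 + 2 / real k) * (b * (real (k - 1) / real k)))"
      using l_ge by (intro powr_mono) auto
  qed (use l_ge in auto)
  also have "\<dots> \<le> 4 / (l * F\<^sup>2)"
  proof (rule divide_left_mono)
    have "F\<^sup>2 \<le> l powr \<eta>" using F_pow_le[of 2] L\<eta>[OF k3] by linarith
    then show "l * F\<^sup>2 \<le> l powr (1 + \<eta>)" using l_ge by (simp add: powr_add)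
  qed (use l_ge F2 in auto)
  finally show ?thesis .
qed

lemma j_bounds: "6 * L \<le> real j" "real j \<le> 7 * L" "1 \<le> j"
proof -
  have "real j = of_int \<lceil>6 * L\<rceil>" using L1 by (simp add: j_def)
  then show "6 * L \<le> real j" "real j \<le> 7 * L" using L1 by linarith+
  then show "1 \<le> j" using L1 by linarith
qed

lemma d_bounds: "5 * l \<le> real d1" "real d1 \<le> 6 * l" "5 * L \<le> real d2" "real d2 \<le> 6 * L"
proof -
  have "real d1 = of_int \<lceil>5 * l\<rceil>" using l_ge by (simp add: d1_def)
  then show "5 * l \<le> real d1" "real d1 \<le> 6 * l" using l_ge by linarith+
  have "real d2 = of_int \<lceil>5 * L\<rceil>" using L1 by (simp add: d2_def)
  then show "5 * L \<le> real d2" "real d2 \<le> 6 * L" using L1 by linarith+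
qed

lemma lam_pos: "0 < lam"
  using k j_bounds R_ge by (auto simp: lam_def)

lemma hub_prob_le:
  "(real (k * j) * ((real n - 1) / (real s - 1)) powr (real (k - 1) / real k) / lam) ^ j \<le> 1 / l ^ 6"
proof -
  have "(real n - 1) / (real s - 1) \<le> real n / (real n / (3 * R))"
  proof (rule frac_le)
    have "real n / (3 * R) = real n / R / 3" by simp
    then show "real n / (3 * R) \<le> real s - 1" using s_bounds(2,3) by linarith
  qed (use n_ge1 R_ge in auto)
  also have "\<dots> = 3 * R" using n_pos by simp
  finally have "((real n - 1) / (real s - 1)) powr (real (k - 1) / real k) \<le> (3 * R) powr (real (k - 1) / real k)"
    using s_bounds n_ge1 by (intro powr_mono2) auto
  then have "real (k * j) * ((real n - 1) / (real s - 1)) powr (real (k - 1) / real k)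
      \<le> real (k * j) * (3 * R) powr (real (k - 1) / real k)"
    by (intro mult_left_mono) auto
  also have "\<dots> = exp (- 1) * lam" by (simp add: lam_def exp_minus)
  finally have "real (k * j) * ((real n - 1) / (real s - 1)) powr (real (k - 1) / real k) / lam \<le> exp (- 1)"
    using lam_pos by (simp add: divide_le_eq)
  then have "(real (k * j) * ((real n - 1) / (real s - 1)) powr (real (k - 1) / real k) / lam) ^ j \<le> exp (- 1) ^ j"
    using lam_pos by (intro power_mono) auto
  also have "\<dots> = exp (- real j)" by (simp flip: exp_of_nat_mult)
  also have "\<dots> \<le> exp (- (6 * L))" using j_bounds by simp
  also have "\<dots> = 1 / exp L ^ 6" by (simp add: exp_minus inverse_eq_divide exp_of_nat_mult[of 6, simplified])
  finally show ?thesis by (simp add: exp_L)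
qed

text \<open>\<open>4\<close> for a missing hub and \<open>1\<close> for a hub in too many cliques.
  After summation over O(l) edges and the charge \<open>B * m \<le> n * F\<close>, the square of
  \<open>F\<close> still leaves \<open>n / F\<close>.\<close>

definition "p = 5 / (l * F\<^sup>2)"

lemma fails_prob_le:
  assumes "length h = m" "valid k h" "u < m"
  shows "(avg k ^^ (n - m)) (\<lambda>h'. of_bool (fails k s lam {k + u, parent k h u} h')) h \<le> p"
proof -
  have parent: "parent k h u < k + u" using parent_less[of k u h] assms k by simp
  have "(avg k ^^ (n - m)) (\<lambda>h'. of_bool (fails k s lam {k + u, parent k h u} h')) h
    \<le> (y * ((real m + 1) / (real s + 1)) powr (b / real k)) ^ (k - 1)
      + (real (k * j) * ((real n - 1) / (real s - 1)) powr (real (k - 1) / real k) / lam) ^ j"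
    unfolding y_def
  proof (rule avg_fails[OF k])
    show "b \<le> 1 - (((real s + 1) / (real n + 1)) powr (1 / real k)) ^ (k - 2)"
      by (simp add: b_def y_def)
  qed (use assms parent s_bounds j_bounds lam_pos b_bounds card_containing_parent[of k u h] k in auto)
  also have "\<dots> \<le> 4 / (l * F\<^sup>2) + 1 / l ^ 6"
    by (intro add_mono miss_prob_le hub_prob_le)
  also have "1 / l ^ 6 \<le> 1 / (l * F\<^sup>2)"
  proof (rule divide_left_mono)
    have "l * F\<^sup>2 \<le> l ^ 1 * l ^ 1"
      using F_pow_le[of 2] Ll l_ge by (intro mult_mono) auto
    also have "\<dots> = l ^ 2" by (simp add: power2_eq_square)
    also have "\<dots> \<le> l ^ 6" using l_ge by (intro power_increasing) auto
    finally show "l * F\<^sup>2 \<le> l ^ 6" .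
  qed (use l_ge F2 in auto)
  finally show ?thesis by (simp add: p_def)
qed

lemma two_power_ge:
  assumes "5 * x \<le> real d" "0 \<le> x" shows "exp x ^ 3 \<le> 2 ^ d"
proof -
  have "exp x ^ 3 = exp (3 * x)" by (simp add: exp_of_nat_mult[of 3, simplified])
  also have "\<dots> \<le> exp (real d * ln 2)"
  proof -
    have "3 * x \<le> real d * (3 / 5)" using assms by simp
    also have "\<dots> \<le> real d * ln 2" using ln2_ge_two_thirds by (intro mult_left_mono) auto
    finally show ?thesis by simp
  qed
  also have "\<dots> = 2 ^ d" by (simp add: exp_of_nat_mult)
  finally show ?thesis .
qed

lemma bad_le:
  "(avg k ^^ n) (\<lambda>h. real (card {v. v < k + n \<and> \<not> good k (B + lam) (real d2 * B + real d1 * (2 * lam)) h v})) []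
    \<le> 40 * (real k + 1)\<^sup>2 * (real n / F)"
proof -
  let ?N = "real (k * m + 1)" and ?K = "real k + 1"
  have mpos: "0 < real m" using m_bounds(3) by simp
  have N: "?N \<le> ?K * real m" using m_bounds(3) by (simp add: algebra_simps)
  have nF: "0 \<le> real n / F" using F2 by simp
  have Bm: "B * real m \<le> real n * F"
  proof -
    have "B * real m \<le> B * (real n / S)" using m_bounds(1) B_pos by (intro mult_left_mono) auto
    also have "\<dots> = real n * F" using S_pos by (simp add: B_def)
    finally show ?thesis .
  qed
  have Nsq: "?N * (real n / real m)\<^sup>2 \<le> 2 * ?K * real n * S"
  proof -
    have "?N * (real n / real m)\<^sup>2 \<le> ?K * real m * (real n / real m)\<^sup>2" using N by (intro mult_right_mono) auto
    also have "\<dots> = ?K * real n * (real n / real m)" using mpos by (simp add: power2_eq_square)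
    also have "\<dots> \<le> ?K * real n * (2 * S)"
      using m_bounds(2) mpos S_pos by (intro mult_left_mono) (auto simp: field_simps)
    also have "\<dots> = 2 * ?K * real n * S" by (simp only: ac_simps)
    finally show ?thesis .
  qed
  have t1: "real (k + m) \<le> ?K * (real n / F)"
  proof -
    have "real (k + m) \<le> ?K * real m"
      using mult_left_mono[of 1 "real m" "real k"] m_bounds(3) by (simp add: algebra_simps)
    also have "\<dots> \<le> ?K * (real n / S)" using m_bounds(1) by (intro mult_left_mono) auto
    also have "\<dots> \<le> ?K * (real n / F)" using F_le_S F2 by (intro mult_left_mono divide_left_mono) auto
    finally show ?thesis .
  qed
  have t2: "?N * (real (Suc k) * (real n / real m)\<^sup>2) / B \<le> 2 * ?K\<^sup>2 * (real n / F)"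
  proof -
    have "?N * (real (Suc k) * (real n / real m)\<^sup>2) / B = ?K * (?N * (real n / real m)\<^sup>2) / B"
      by (simp add: mult_ac)
    also have "\<dots> \<le> ?K * (2 * ?K * real n * S) / B"
      using Nsq B_pos by (intro divide_right_mono mult_left_mono) auto
    also have "\<dots> = 2 * ?K\<^sup>2 * (real n / F)" using S_pos by (simp add: B_def power2_eq_square)
    finally show ?thesis .
  qed
  have t3: "?N * (real n / real m)\<^sup>2 / 2 ^ d2 \<le> 2 * ?K * (real n / F)"
  proof -
    have "B \<le> 2 ^ d2" using B_le two_power_ge[of L d2] d_bounds(3) L1 by (simp add: exp_L)
    then have "?N * (real n / real m)\<^sup>2 / 2 ^ d2 \<le> (2 * ?K * real n * S) / B"
      using Nsq B_pos S_pos by (intro frac_le) auto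
    also have "\<dots> = 2 * ?K * (real n / F)" using S_pos by (simp add: B_def)
    finally show ?thesis .
  qed
  have t4: "B * ((1 + 2 * real k) * (real m)\<^sup>2) / 2 ^ d1 \<le> (1 + 2 * real k) * (real n / F)"
  proof -
    have Fn: "F \<le> real n" using F_le_S S_le_n S_pos by linarith
    have "B * ((1 + 2 * real k) * (real m)\<^sup>2) / 2 ^ d1 = (1 + 2 * real k) * ((B * real m) * real m) / 2 ^ d1"
      by (simp add: power2_eq_square)
    also have "\<dots> \<le> (1 + 2 * real k) * ((real n * F) * real n) / real n ^ 3"
    proof (rule frac_le)
      show "(1 + 2 * real k) * ((B * real m) * real m) \<le> (1 + 2 * real k) * ((real n * F) * real n)"
        using m_bounds(4) F2 by (intro mult_left_mono mult_mono[OF Bm]) auto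
      show "real n ^ 3 \<le> 2 ^ d1" using two_power_ge[of l d1] d_bounds(1) l_ge by (simp add: exp_l)
    qed (use n_pos F2 in auto)
    also have "\<dots> = (1 + 2 * real k) * (F / real n)" using n_pos by (simp add: power3_eq_cube)
    also have "\<dots> \<le> (1 + 2 * real k) * (real n / F)"
      using Fn F2 n_pos by (intro mult_left_mono frac_le) auto
    finally show ?thesis .
  qed
  have t5: "B * (?N * (real d1 * p)) \<le> 30 * ?K * (real n / F)"
  proof -
    have p0: "0 \<le> p" using l_ge by (simp add: p_def)
    have "B * (?N * (real d1 * p)) \<le> B * ((?K * real m) * (6 * l * p))"
      using N d_bounds B_pos p0 l_ge by (intro mult_left_mono mult_mono mult_right_mono) auto
    also have "\<dots> = ?K * (B * real m) * (6 * l * p)" by (simp add: mult_ac)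
    also have "\<dots> \<le> ?K * (real n * F) * (6 * l * p)"
      using Bm p0 l_ge by (intro mult_right_mono mult_left_mono) auto
    also have "\<dots> = 30 * ?K * (real n / F)"
      using l_ge F2 by (simp add: p_def power2_eq_square)
    finally show ?thesis .
  qed
  have "(avg k ^^ n) (\<lambda>h. real (card {v. v < k + n \<and> \<not> good k (B + lam) (real d2 * B + real d1 * (2 * lam)) h v})) []
    \<le> real (k + m) + ?N * (real (Suc k) * (real n / real m)\<^sup>2) / B + ?N * (real n / real m)\<^sup>2 / 2 ^ d2
      + B * ((1 + 2 * real k) * (real m)\<^sup>2) / 2 ^ d1 + B * (?N * (real d1 * p))"
    using l_ge by (intro expected_bad_le[OF k m_bounds(3,4) B_pos lam_pos fails_prob_le]) (auto simp: p_def)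
  also have "\<dots> \<le> ?K * (real n / F) + 2 * ?K\<^sup>2 * (real n / F) + 2 * ?K * (real n / F)
      + (1 + 2 * real k) * (real n / F) + 30 * ?K * (real n / F)"
    by (intro add_mono t1 t2 t3 t4 t5)
  also have "\<dots> = (?K + 2 * ?K\<^sup>2 + 2 * ?K + (1 + 2 * real k) + 30 * ?K) * (real n / F)"
    by (simp only: distrib_right)
  also have "\<dots> \<le> 40 * ?K\<^sup>2 * (real n / F)"
    by (rule mult_right_mono[OF _ nF]) (simp add: power2_eq_square algebra_simps)
  finally show ?thesis .
qed

text \<open>The exponent of \<open>R\<close> was chosen so that 2/(k-1) times (k-1)/k is 2/k. The
  constant is 3 * 7 * 3, from \<open>exp 1 \<le> 3\<close>, \<open>j \<le> 7 * L\<close> and the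
  factor \<open>3\<close> of \<open>R\<close>.\<close>

lemma lam_le: "l * lam \<le> 63 * real k * (l powr (1 + 2 / real k) * L * F ^ 5)"
proof -
  let ?a = "real (k - 1) / real k"
  have "real (k - 1) \<noteq> 0" using k by simp
  then have "2 / real (k - 1) * ?a = 2 / real k" by (simp del: of_nat_diff)
  then have "(l powr (2 / real (k - 1))) powr ?a = l powr (2 / real k)"
    by (simp only: powr_powr)
  then have "R powr ?a = l powr (2 / real k) * (F powr 4) powr ?a"
    using F2 by (simp add: R_def powr_mult powr_numeral)
  also have "(F powr 4) powr ?a = F powr (4 * ?a)" by (rule powr_powr)
  also have "\<dots> \<le> F powr 5" using F2 k by (intro powr_mono) (auto simp: field_simps)
  also have "F powr 5 = F ^ 5" using F2 by (simp add: powr_numeral)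
  finally have Ra: "R powr ?a \<le> l powr (2 / real k) * F ^ 5" by (simp add: mult_left_mono)
  have "3 powr ?a \<le> 3 powr 1" using frac_le_1 by (intro powr_mono) auto
  then have "(3 * R) powr ?a \<le> 3 * (l powr (2 / real k) * F ^ 5)"
    using Ra R_ge by (simp only: powr_mult) (intro mult_mono, auto)
  then have "lam \<le> 3 * real k * (7 * L) * (3 * (l powr (2 / real k) * F ^ 5))"
    unfolding lam_def using j_bounds(2) L1 exp_le F2 by (intro mult_mono) auto
  then have "l * lam \<le> l * (3 * real k * (7 * L) * (3 * (l powr (2 / real k) * F ^ 5)))"
    using l_ge by (intro mult_left_mono) auto
  also have "\<dots> = 63 * real k * (l powr (1 + 2 / real k) * L * F ^ 5)"
    using l_ge by (simp add: powr_add)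
  finally show ?thesis .
qed

lemma prob_ge:
  assumes T: "3328 * real k * (l powr (1 + 2 / real k) * L * F ^ 5) \<le> real T"
    and gg: "0 < gg" "gg \<le> real (n + k)" and kn: "k \<le> n"
  shows "1 - real n * (80 * (real k + 1)\<^sup>2 / F + 2 / l) / gg
    \<le> measure_pmf.prob (rumor_spread k n T) {I. real n - gg \<le> real (card I)}"
proof -
  let ?Tc = "l powr (1 + 2 / real k) * L * F ^ 5" and ?Q = "real d2 * B + real d1 * (2 * lam)"
  let ?M = "B + lam"
  have LB: "L * B = ?Tc" by (simp add: B_def S_def eval_nat_numeral)
  have Tc0: "0 \<le> ?Tc" using L1 F2 by simp
  have k1: "1 \<le> real k" using k by simp
  have "real d2 * B \<le> 6 * L * B" using d_bounds B_pos by (intro mult_right_mono) auto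
  also have "\<dots> = 6 * ?Tc" using LB by simp
  also have "\<dots> \<le> 6 * real k * ?Tc" using k1 Tc0 by (simp add: mult_right_mono)
  finally have q1: "real d2 * B \<le> 6 * real k * ?Tc" .
  have "real d1 * (2 * lam) \<le> 6 * l * (2 * lam)" using d_bounds lam_pos by (intro mult_right_mono) auto
  then have q2: "real d1 * (2 * lam) \<le> 756 * real k * ?Tc" using lam_le by linarith
  have Q: "?Q \<le> 762 * real k * ?Tc" using q1 q2 by linarith
  have "L * lam \<le> l * lam" using L_le_l lam_pos by (intro mult_right_mono) auto
  have "L * ?M \<le> ?Tc + 63 * real k * ?Tc" unfolding distrib_left LB using \<open>L * lam \<le> l * lam\<close> lam_le by linarith
  also have "\<dots> \<le> 64 * real k * ?Tc" using mult_right_mono[OF k1 Tc0] by linarith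
  finally have M: "L * ?M \<le> 64 * real k * ?Tc" .
  have Mpos: "0 < ?M" using B_pos lam_pos by simp
  have "0 \<le> real k * ?Tc" using Tc0 by simp
  \<comment> \<open>\<open>3328\<close> leaves room for \<open>4 * 762 + 2 * 64\<close>: the first
    term covers the walks of source and target, the second lowers the failure probability to
    \<open>exp (- L) = 1 / l\<close>.\<close>
  moreover have "4 * q - t \<le> - (2 * w)" if "0 \<le> x" "q \<le> 762 * x" "w \<le> 64 * x" "3328 * x \<le> t" for q t w x :: real
    using that by linarith
  ultimately have "4 * ?Q - real T \<le> - (2 * (L * ?M))"
    using Q M T unfolding mult.assoc[of _ "real k"] by blast
  then have "(4 * ?Q - real T) / (2 * ?M) \<le> - L"
    using Mpos by (simp add: divide_le_eq algebra_simps)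
  then have "exp ((4 * ?Q - real T) / (2 * ?M)) \<le> exp (- L)" by simp
  also have "\<dots> = 1 / l" by (simp add: exp_minus exp_L inverse_eq_divide)
  finally have "real (n + k) * exp ((4 * ?Q - real T) / (2 * ?M)) \<le> (2 * real n) * (1 / l)"
    using kn by (intro mult_mono) auto
  then have "(2 * (40 * (real k + 1)\<^sup>2 * (real n / F)) + real (n + k) * exp ((4 * ?Q - real T) / (2 * ?M))) / gg
      \<le> (2 * (40 * (real k + 1)\<^sup>2 * (real n / F)) + (2 * real n) * (1 / l)) / gg"
    using gg by (intro divide_right_mono add_left_mono) auto
  also have "\<dots> = real n * (80 * (real k + 1)\<^sup>2 / F + 2 / l) / gg"
    by (simp add: algebra_simps)
  finally have 1: "(2 * (40 * (real k + 1)\<^sup>2 * (real n / F)) + real (n + k) * exp ((4 * ?Q - real T) / (2 * ?M))) / gg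
      \<le> real n * (80 * (real k + 1)\<^sup>2 / F + 2 / l) / gg" .
  show ?thesis
    using prob_rumor_spread_ge[OF k Mpos gg bad_le, of T] 1 by linarith
qed

end

section \<open>Asymptotics in \<open>n\<close>\<close>

lemma filterlim_powr_at_top:
  fixes c :: real
  assumes "0 < c" "filterlim f at_top F"
  shows "filterlim (\<lambda>n. f n powr c) at_top F"
proof -
  have "filterlim (\<lambda>x::real. x powr c) at_top at_top" using assms(1) by real_asymp
  from filterlim_compose[OF this assms(2)] show ?thesis .
qed

text \<open>The exponent \<open>3 / (5 * k)\<close> turns \<open>F ^ 5\<close> into
  \<open>f powr (3 / k)\<close>, the factor in the number of rounds. As \<open>3 / k \<le> 2\<close>
  and eventually \<open>1 \<le> f n \<le> L\<close>, this is at most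
  \<open>L\<^sup>2\<close>.\<close>

lemma eventually_scales:
  fixes f :: "nat \<Rightarrow> real"
  assumes k: "k \<ge> 2" and f: "f \<in> o(\<lambda>n. ln (ln (real n)))" and f_top: "filterlim f at_top sequentially"
  shows "eventually (\<lambda>n. scales k n (ln (real n)) (ln (ln (real n))) (f n powr (3 / (5 * real k)))
    (real (k - 2) / (2 * (real k)\<^sup>2))) sequentially"
proof -
  let ?\<eta> = "real (k - 2) / (2 * (real k)\<^sup>2)" and ?F = "\<lambda>n. f n powr (3 / (5 * real k))"
  have F_top: "filterlim ?F at_top sequentially"
    by (rule filterlim_powr_at_top[OF _ f_top]) (use k in auto)
  have e1: "eventually (\<lambda>n. 1 \<le> ln (ln (real n))) sequentially" by real_asymp
  have e2: "eventually (\<lambda>n. 2 \<le> ?F n) sequentially" using F_top by (simp add: filterlim_at_top)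
  have e3: "eventually (\<lambda>n. (ln (ln (real n)))\<^sup>2 \<le> ln (real n)) sequentially" by real_asymp
  have e4: "eventually (\<lambda>n. 3 * ln (real n) ^ 4 \<le> real n) sequentially" by real_asymp
  have e5: "eventually (\<lambda>n. 1 \<le> f n) sequentially" using f_top by (simp add: filterlim_at_top)
  have e6: "eventually (\<lambda>n. norm (f n) \<le> 1 * norm (ln (ln (real n)))) sequentially"
    using landau_o.smallD[OF f, of 1] by simp
  have e7: "eventually (\<lambda>n. ?F n ^ 5 \<le> (ln (ln (real n)))\<^sup>2) sequentially"
    using e1 e5 e6
  proof eventually_elim
    case (elim n)
    have "?F n ^ 5 = f n powr (3 / real k)"
      using elim by (simp add: powr_powr flip: powr_numeral)
    also have "\<dots> \<le> f n powr 2" using elim k by (intro powr_mono) (auto simp: field_simps)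
    also have "\<dots> = (f n)\<^sup>2" using elim by (simp add: powr_numeral)
    also have "\<dots> \<le> (ln (ln (real n)))\<^sup>2" using elim by (intro power_mono) auto
    finally show ?case .
  qed
  have e8: "eventually (\<lambda>n. k \<ge> 3 \<longrightarrow> (2 / ?F n) powr (real (k - 2) / real k) * (1 + 2 * ?\<eta>) \<le> ?\<eta>) sequentially"
  proof (cases "k \<ge> 3")
    case True
    have "((\<lambda>n. (2 / ?F n) powr (real (k - 2) / real k) * (1 + 2 * ?\<eta>)) \<longlongrightarrow> 0 powr (real (k - 2) / real k) * (1 + 2 * ?\<eta>)) sequentially"
    proof (intro tendsto_mult tendsto_const tendsto_powr')
      show "((\<lambda>n. 2 / ?F n) \<longlongrightarrow> 0) sequentially"
        by (rule tendsto_divide_0[OF tendsto_const]) (rule filterlim_at_top_imp_at_infinity[OF F_top])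
    qed (use True in auto)
    then have "eventually (\<lambda>n. (2 / ?F n) powr (real (k - 2) / real k) * (1 + 2 * ?\<eta>) < ?\<eta>) sequentially"
      using True by (intro order_tendstoD(2)) auto
    then show ?thesis by eventually_elim (simp only: less_imp_le simp_thms)
  qed auto
  have e9: "eventually (\<lambda>n. k \<ge> 3 \<longrightarrow> (ln (ln (real n)))\<^sup>2 \<le> ln (real n) powr ?\<eta>) sequentially"
  proof (cases "k \<ge> 3")
    case True
    define c where "c = ?\<eta>"
    have "c > 0" using True by (simp add: c_def)
    then have "eventually (\<lambda>n. (ln (ln (real n)))\<^sup>2 \<le> ln (real n) powr c) sequentially" by real_asymp
    then show ?thesis unfolding c_def by eventually_elim auto
  qed auto
  show ?thesis
    using e1 e2 e3 e4 e7 e8 e9 by eventually_elim (use k in \<open>auto simp: scales_def\<close>)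
qed

theorem theorem1:
  fixes k :: nat and f :: "nat \<Rightarrow> real"
  assumes "k \<ge> 2"
    and "f \<in> o(\<lambda>n. ln (ln (real n)))"
    and "filterlim f at_top sequentially"
  shows "\<exists>C > 0. \<exists>g :: nat \<Rightarrow> real. g \<in> o(\<lambda>n. real n) \<and>
    ((\<lambda>n. measure_pmf.prob (rumor_spread k n (num_rounds C k f n))
        {I. real (card I) \<ge> real n - g n}) \<longlongrightarrow> 1) sequentially"
proof -
  let ?F = "\<lambda>n. f n powr (3 / (5 * real k))"
  define C where "C = 3328 * real k"
  define \<epsilon> where "\<epsilon> n = 80 * (real k + 1)\<^sup>2 / ?F n + 2 / ln (real n)" for n
  \<comment> \<open>The square root balances both demands: \<open>g n / n\<close> and the failure
    bound \<open>n * \<epsilon> n / g n\<close> both equal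
    \<open>sqrt (\<epsilon> n)\<close>.\<close>
  define g where "g n = real n * sqrt (\<epsilon> n)" for n
  have F_top: "filterlim ?F at_top sequentially"
    by (rule filterlim_powr_at_top[OF _ assms(3)]) (use assms(1) in auto)
  have "((\<lambda>n. 80 * (real k + 1)\<^sup>2 / ?F n) \<longlongrightarrow> 0) sequentially"
    by (rule tendsto_divide_0[OF tendsto_const]) (rule filterlim_at_top_imp_at_infinity[OF F_top])
  moreover have "((\<lambda>n. 2 / ln (real n)) \<longlongrightarrow> 0) sequentially" by real_asymp
  ultimately have \<epsilon>0: "(\<epsilon> \<longlongrightarrow> 0) sequentially"
    unfolding \<epsilon>_def using tendsto_add[of _ 0 _ _ 0] by fastforce
  have sq0: "((\<lambda>n. sqrt (\<epsilon> n)) \<longlongrightarrow> 0) sequentially"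
    using tendsto_real_sqrt[OF \<epsilon>0] by simp
  have "eventually (\<lambda>n::nat. real n \<noteq> 0) sequentially"
    using eventually_gt_at_top[of 0] by eventually_elim simp
  moreover have "((\<lambda>n. g n / real n) \<longlongrightarrow> 0) sequentially"
    by (rule Lim_transform_eventually[OF sq0]) (use calculation in eventually_elim, simp add: g_def)
  ultimately have g_o: "g \<in> o(\<lambda>n. real n)" by (intro smalloI_tendsto)
  have lower: "eventually (\<lambda>n. 1 - sqrt (\<epsilon> n) \<le>
      measure_pmf.prob (rumor_spread k n (num_rounds C k f n)) {I. real (card I) \<ge> real n - g n}) sequentially"
    using eventually_scales[OF assms] order_tendstoD(2)[OF \<epsilon>0, of 1, OF zero_less_one]
      eventually_ge_at_top[of k] eventually_gt_at_top[of 1] filterlim_at_top_dense[THEN iffD1, OF assms(3), rule_format, of 0]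
  proof eventually_elim
    case (elim n)
    interpret scales k n "ln (real n)" "ln (ln (real n))" "?F n" "real (k - 2) / (2 * (real k)\<^sup>2)"
      by (rule elim)
    have eps: "0 < \<epsilon> n" unfolding \<epsilon>_def using F2 l_ge by (intro add_nonneg_pos) auto
    have "?F n ^ 5 = f n powr (3 / real k)"
      using elim by (simp add: powr_powr flip: powr_numeral)
    then have T: "3328 * real k * (ln (real n) powr (1 + 2 / real k) * ln (ln (real n)) * ?F n ^ 5)
        \<le> real (num_rounds C k f n)"
      unfolding num_rounds_def C_def by (simp add: mult.assoc) linarith
    have "sqrt (\<epsilon> n) \<le> 1" using elim by simp
    then have "g n \<le> real (n + k)" using mult_left_mono[of "sqrt (\<epsilon> n)" 1 "real n"] by (simp add: g_def)
    moreover have gpos: "0 < g n" using eps elim by (simp add: g_def)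
    ultimately have "1 - real n * \<epsilon> n / g n
        \<le> measure_pmf.prob (rumor_spread k n (num_rounds C k f n)) {I. real n - g n \<le> real (card I)}"
      using prob_ge[OF T] elim unfolding \<epsilon>_def by simp
    moreover have "real n * \<epsilon> n / g n = sqrt (\<epsilon> n)"
      using eps elim by (simp add: g_def real_div_sqrt)
    ultimately show ?case by simp
  qed
  have lim: "((\<lambda>n. 1 - sqrt (\<epsilon> n)) \<longlongrightarrow> 1) sequentially"
    using tendsto_diff[OF tendsto_const sq0, of 1] by simp
  have "((\<lambda>n. measure_pmf.prob (rumor_spread k n (num_rounds C k f n))
      {I. real (card I) \<ge> real n - g n}) \<longlongrightarrow> 1) sequentially"
    by (rule tendsto_sandwich[OF lower _ lim tendsto_const]) simp
  then show ?thesis using g_o assms(1) by (intro exI[of _ C]) (auto simp: C_def)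
qed

end
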